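(* Suppose $\mathfrak{C}_{AR(1)}\subseteq\mathfrak{C}$, the weights $w(j,n)$ are admissible, and the pair $(X,R)$ satisfies the rank condition. Let $0<C<\infty$ and $W(C)=\{y\in\mathbb{R}^n: T(y)\ge C\}$. Then: 1. Suppose $\operatorname{rank}(B(e_+))=q$ and $T(e_++\mu_0^* )>C$ hold for some (and hence all) $\mu_0^*\in\mathfrak{M}_0$, or $\operatorname{rank}(B(e_-))=q$ and $T(e_-+\mu_0^* )>C$ hold for some (and hence all) $\mu_0^*\in\mathfrak{M}_0$. Then $\sup_{\Sigma\in\mathfrak{C}}P_{\mu_0,\sigma^2\Sigma}(W(C))=1$ for every $\mu_0\in\mathfrak{M}_0$ and every $0<\sigma^2<\infty$. In particular, the size of the test equals one. 2. Suppose $\operatorname{rank}(B(e_+))=q$ and $T(e_++\mu_0^* )<C$ hold for some (and hence all) $\mu_0^*\in\mathfrak{M}_0$, or $\operatorname{rank}(B(e_-))=q$ and $T(e_-+\mu_0^* )<C$ hold for some (and hence all) $\mu_0^*\in\mathfrak{M}_0$. Then $\inf_{\Sigma\in\mathfrak{C}}P_{\mu_0,\sigma^2\Sigma}(W(C))=0$ for every $\mu_0\in\mathfrak{M}_0$ and every $0<\sigma^2<\infty$, and hence $\inf_{\mu_1\in\mathfrak{M}_1}\inf_{\Sigma\in\mathfrak{C}}P_{\mu_1,\sigma^2\Sigma}(W(C))=0$ for every $0<\sigma^2<\infty$. In particular, the test is biased. Furthermore, for every $\mu_1\in\mathfrak{M}_1$, $\inf_{0<\sigma^2<\infty}\inf_{\Sigma\in\mathfrak{C}}P_{\mu_1,\sigma^2\Sigma}(W(C))=0$.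 In particular, the infimal power of the test equals zero. 3. Suppose $B(e_+)=0$ and $R\hat\beta(e_+)\ne0$ hold, or $B(e_-)=0$ and $R\hat\beta(e_-)\ne0$ hold. Then $\sup_{\Sigma\in\mathfrak{C}}P_{\mu_0,\sigma^2\Sigma}(W(C))=1$ for every $\mu_0\in\mathfrak{M}_0$ and every $0<\sigma^2<\infty$. In particular, the size of the test equals one.
   Context: Framework: $n,k,q$ are integers with $1\le k<n$, $q\ge1$; $X$ is a fixed real $n\times k$ matrix of rank $k$; $R$ is a fixed real $q\times k$ matrix of rank $q$; $r\in\mathbb{R}^q$. $\mathfrak{C}$ (covariance model) is a nonempty set of symmetric positive definite $n\times n$ matrices such that $\sigma^2\in(0,\infty)$ and $\Sigma\in\mathfrak{C}$ are uniquely determined by $\sigma^2\Sigma$. $\mathfrak{M}=\operatorname{span}(X)$ (column space), $\mathfrak{M}_0=\{X\beta:\beta\in\mathbb{R}^k,\ R\beta=r\}$, $\mathfrak{M}_1=\mathfrak{M}\setminus\mathfrak{M}_0$. $P_{\mu,\Phi}$ is the Gaussian measure on $\mathbb{R}^n$ with mean $\mu$ and covariance matrix $\Phi$. The testing problem is $H_0:\mu\in\mathfrak{M}_0$, $0<\sigma^2<\infty$, $\Sigma\in\mathfrak{C}$ versus $H_1:\mu\in\mathfrak{M}_1$, $0<\sigma^2<\infty$, $\Sigma\in\mathfrak{C}$, the observation being distributed as $P_{\mu,\sigma^2\Sigma}$. For a rejection region $W$, the size is the supremum of $P_{\mu,\sigma^2\Sigma}(W)$ over $H_0$, the infimal power is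 the infimum of $P_{\mu,\sigma^2\Sigma}(W)$ over $H_1$, and the test is biased if its infimal power is strictly smaller than its size. $\hat\beta(y)=(X'X)^{-1}X'y$. AR(1) matrices: $\Lambda(\rho)$ is the $n\times n$ matrix with $(i,j)$ entry $\rho^{|i-j|}$; $\mathfrak{C}_{AR(1)}=\{\Lambda(\rho):\rho\in(-1,1)\}$. $e_+=(1,\dots,1)'$, $e_-=(-1,1,\dots,(-1)^n)'$ in $\mathbb{R}^n$; $e_i(n)$ is the $i$-th standard basis vector. Test statistic: the weights $w(j,n)$, $j=-(n-1),\dots,n-1$, are data-independent reals; they are called admissible if $w(0,n)=1$, $w(-j,n)=w(j,n)$, and the symmetric Toeplitz matrix $\mathcal{W}_n=(w(i-j,n))_{i,j=1}^n$ is positive definite. Let $\hat u(y)=y-X\hat\beta(y)$ with coordinates $\hat u_t(y)$, $x_{t\cdot}$ the $t$-th row of $X$, $\hat v_t(y)=\hat u_t(y)x_{t\cdot}'$, $\hat\Gamma_j(y)=n^{-1}\sum_{t=j+1}^n\hat v_t(y)\hat v_{t-j}(y)'$ for $j\ge0$, $\hat\Gamma_j(y)=\hat\Gamma_{-j}(y)'$ for $j<0$, $\hat\Psi_w(y)=\sum_{j=-(n-1)}^{n-1}w(j,n)\hat\Gamma_j(y)$, $\hat\Omega_w(y)=nR(X'X)^{-1}\hat\Psi_w(y)(X'X)^{-1}R'$. Then $T(y)=(R\hat\beta(y)-r)'\hat\Omega_w^{-1}(y)(R\hat\beta(y)-r)$ if $\det\hat\Omega_w(y)\ne0$ and $T(y)=0$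 otherwise. Also $B(y)=R(X'X)^{-1}X'\operatorname{diag}(\hat u_1(y),\dots,\hat u_n(y))$. Rank condition on $(X,R)$: let $i_1<\dots<i_s$ be all indices $i$ with $e_i(n)\in\operatorname{span}(X)$ ($s=0$ if there are none) and let $X'(\neg(i_1,\dots,i_s))$ be $X'$ with the columns with these indices deleted; then $\operatorname{rank}(R(X'X)^{-1}X'(\neg(i_1,\dots,i_s)))=q$. *)

theory Defs
  imports "HOL-Analysis.Analysis"
begin

section \<open>Coordinates\<close>

text \<open>
  Observations are vectors of type \<open>real ^ 'n\<close> with \<open>n = CARD('n)\<close>. The order on the
  index type serves as the time order: \<open>pos i\<close> in \<open>{1..n}\<close> is the time label of the
  coordinate \<open>i\<close>, and \<open>at_time\<close> is the inverse of \<open>pos\<close>.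
\<close>

definition pos :: "'n::{finite,linorder} \<Rightarrow> nat"
  where "pos i = card {..i}"

definition at_time :: "nat \<Rightarrow> 'n::{finite,linorder}"
  where "at_time t = inv_into UNIV pos t"

lemma strict_mono_pos: "strict_mono (pos :: 'n::{finite,linorder} \<Rightarrow> nat)"
proof (rule strict_monoI)
  fix i j :: 'n
  assume "i < j"
  then have "{..i} \<subset> {..j}" by auto
  then show "pos i < pos j" unfolding pos_def by (intro psubset_card_mono) auto
qed

lemma bij_betw_pos: "bij_betw pos (UNIV :: 'n::{finite,linorder} set) {1..CARD('n)}"
proof -
  have inj: "inj (pos :: 'n \<Rightarrow> nat)"
    by (rule strict_mono_imp_inj_on[OF strict_mono_pos])
  have "range (pos :: 'n \<Rightarrow> nat) \<subseteq> {1..CARD('n)}"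
  proof
    fix t assume "t \<in> range (pos :: 'n \<Rightarrow> nat)"
    then obtain i :: 'n where "t = card {..i}" by (auto simp: pos_def)
    moreover have "card {..i} > 0" by (subst card_gt_0_iff) auto
    ultimately show "t \<in> {1..CARD('n)}" by (auto simp: card_mono)
  qed
  moreover have "card (range (pos :: 'n \<Rightarrow> nat)) = CARD('n)"
    by (rule card_image[OF inj])
  ultimately have "range (pos :: 'n \<Rightarrow> nat) = {1..CARD('n)}"
    by (intro card_subset_eq) auto
  with inj show ?thesis by (simp add: bij_betw_def)
qed

definition e_plus :: "real ^ 'n"
  where "e_plus = (\<chi> i. 1)"

definition e_minus :: "real ^ 'n::{finite,linorder}"
  where "e_minus = (\<chi> i. (- 1) ^ pos i)"

definition diag_mat :: "real ^ 'n \<Rightarrow> real ^ 'n ^ 'n"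
  where "diag_mat u = (\<chi> i j. if i = j then u $ i else 0)"

definition outer :: "real ^ 'm \<Rightarrow> real ^ 'n \<Rightarrow> real ^ 'n ^ 'm"
  where "outer u v = (\<chi> i j. u $ i * v $ j)"


section \<open>Covariance models and Gaussian measures\<close>

definition sym_posdef :: "real ^ 'n ^ 'n \<Rightarrow> bool"
  where "sym_posdef A \<longleftrightarrow> transpose A = A \<and> (\<forall>x. x \<noteq> 0 \<longrightarrow> x \<bullet> (A *v x) > 0)"

definition covariance_model :: "(real ^ 'n ^ 'n) set \<Rightarrow> bool"
  where "covariance_model \<CC> \<longleftrightarrow>
    \<CC> \<noteq> {} \<and> (\<forall>\<Sigma>\<in>\<CC>. sym_posdef \<Sigma>) \<and>
    (\<forall>s s' \<Sigma> \<Sigma>'. s > 0 \<longrightarrow> s' > 0 \<longrightarrow> \<Sigma> \<in> \<CC> \<longrightarrow> \<Sigma>' \<in> \<CC> \<longrightarrow>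
       s *\<^sub>R \<Sigma> = s' *\<^sub>R \<Sigma>' \<longrightarrow> s = s' \<and> \<Sigma> = \<Sigma>')"

definition AR1_mat :: "real \<Rightarrow> real ^ 'n::{finite,linorder} ^ 'n::{finite,linorder}"
  where "AR1_mat \<rho> = (\<chi> i j. \<rho> ^ nat \<bar>int (pos i) - int (pos j)\<bar>)"

definition AR1_model :: "(real ^ 'n::{finite,linorder} ^ 'n::{finite,linorder}) set"
  where "AR1_model = {AR1_mat \<rho> | \<rho>. - 1 < \<rho> \<and> \<rho> < 1}"

text \<open>
  The Gaussian measure with mean \<open>\<mu>\<close> and covariance matrix \<open>\<Phi>\<close>, given by its Lebesgue
  density; only meaningful (and only used) for symmetric positive definite \<open>\<Phi>\<close>.
\<close>

definition gaussian :: "real ^ 'n \<Rightarrow> real ^ 'n ^ 'n \<Rightarrow> (real ^ 'n) measure"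
  where "gaussian \<mu> \<Phi> = density lborel (\<lambda>y. ennreal
    (exp (- ((y - \<mu>) \<bullet> (matrix_inv \<Phi> *v (y - \<mu>))) / 2) / sqrt ((2 * pi) ^ CARD('n) * det \<Phi>)))"


section \<open>The testing problem\<close>

definition hyp_all :: "real ^ 'k ^ 'n \<Rightarrow> (real ^ 'n) set"
  where "hyp_all X = span (columns X)"

definition hyp_null :: "real ^ 'k ^ 'n \<Rightarrow> real ^ 'k ^ 'q \<Rightarrow> real ^ 'q \<Rightarrow> (real ^ 'n) set"
  where "hyp_null X R r = {X *v \<beta> | \<beta>. R *v \<beta> = r}"

definition hyp_alt :: "real ^ 'k ^ 'n \<Rightarrow> real ^ 'k ^ 'q \<Rightarrow> real ^ 'q \<Rightarrow> (real ^ 'n) set"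
  where "hyp_alt X R r = hyp_all X - hyp_null X R r"

text \<open>The probability of the rejection region \<open>W\<close> at the parameter \<open>(\<mu>, \<sigma>\<^sup>2, \<Sigma>)\<close>, with \<open>s = \<sigma>\<^sup>2\<close>.\<close>

definition rej_prob :: "(real ^ 'n) set \<Rightarrow> real ^ 'n \<Rightarrow> real \<Rightarrow> real ^ 'n ^ 'n \<Rightarrow> real"
  where "rej_prob W \<mu> s \<Sigma> = measure (gaussian \<mu> (s *\<^sub>R \<Sigma>)) W"

definition test_size ::
  "real ^ 'k ^ 'n \<Rightarrow> real ^ 'k ^ 'q \<Rightarrow> real ^ 'q \<Rightarrow> (real ^ 'n ^ 'n) set \<Rightarrow> (real ^ 'n) set \<Rightarrow> real"
  where "test_size X R r \<CC> W =
    (SUP (\<mu>, s, \<Sigma>) \<in> hyp_null X R r \<times> {0<..} \<times> \<CC>. rej_prob W \<mu> s \<Sigma>)"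

definition infimal_power ::
  "real ^ 'k ^ 'n \<Rightarrow> real ^ 'k ^ 'q \<Rightarrow> real ^ 'q \<Rightarrow> (real ^ 'n ^ 'n) set \<Rightarrow> (real ^ 'n) set \<Rightarrow> real"
  where "infimal_power X R r \<CC> W =
    (INF (\<mu>, s, \<Sigma>) \<in> hyp_alt X R r \<times> {0<..} \<times> \<CC>. rej_prob W \<mu> s \<Sigma>)"

definition biased ::
  "real ^ 'k ^ 'n \<Rightarrow> real ^ 'k ^ 'q \<Rightarrow> real ^ 'q \<Rightarrow> (real ^ 'n ^ 'n) set \<Rightarrow> (real ^ 'n) set \<Rightarrow> bool"
  where "biased X R r \<CC> W \<longleftrightarrow> infimal_power X R r \<CC> W < test_size X R r \<CC> W"


section \<open>The test statistic\<close>

text \<open>\<open>w j\<close> is the weight \<open>w(j,n)\<close>; only the values for \<open>\<bar>j\<bar> \<le> n - 1\<close> are ever used.\<close>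

definition toeplitz :: "(int \<Rightarrow> real) \<Rightarrow> real ^ 'n::{finite,linorder} ^ 'n::{finite,linorder}"
  where "toeplitz w = (\<chi> i j. w (int (pos i) - int (pos j)))"

definition admissible :: "'n::{finite,linorder} itself \<Rightarrow> (int \<Rightarrow> real) \<Rightarrow> bool"
  where "admissible _ w \<longleftrightarrow>
    w 0 = 1 \<and> (\<forall>j. \<bar>j\<bar> \<le> int CARD('n) - 1 \<longrightarrow> w (- j) = w j) \<and>
    sym_posdef (toeplitz w :: real ^ 'n::{finite,linorder} ^ 'n::{finite,linorder})"

definition beta_hat :: "real ^ 'k ^ 'n \<Rightarrow> real ^ 'n \<Rightarrow> real ^ 'k"
  where "beta_hat X y = (matrix_inv (transpose X ** X) ** transpose X) *v y"

definition u_hat :: "real ^ 'k ^ 'n \<Rightarrow> real ^ 'n \<Rightarrow> real ^ 'n"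
  where "u_hat X y = y - X *v beta_hat X y"

definition v_hat :: "real ^ 'k ^ 'n::{finite,linorder} \<Rightarrow> real ^ 'n::{finite,linorder} \<Rightarrow> nat \<Rightarrow> real ^ 'k"
  where "v_hat X y t = (u_hat X y $ at_time t) *\<^sub>R row (at_time t) X"

definition Gamma_hat_nat ::
  "real ^ 'k ^ 'n::{finite,linorder} \<Rightarrow> real ^ 'n::{finite,linorder} \<Rightarrow> nat \<Rightarrow> real ^ 'k ^ 'k"
  where "Gamma_hat_nat X y j =
    (1 / real CARD('n)) *\<^sub>R (\<Sum>t = j + 1..CARD('n). outer (v_hat X y t) (v_hat X y (t - j)))"

definition Gamma_hat ::
  "real ^ 'k ^ 'n::{finite,linorder} \<Rightarrow> real ^ 'n::{finite,linorder} \<Rightarrow> int \<Rightarrow> real ^ 'k ^ 'k"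
  where "Gamma_hat X y j =
    (if j \<ge> 0 then Gamma_hat_nat X y (nat j) else transpose (Gamma_hat_nat X y (nat (- j))))"

definition Psi_hat ::
  "real ^ 'k ^ 'n::{finite,linorder} \<Rightarrow> (int \<Rightarrow> real) \<Rightarrow> real ^ 'n::{finite,linorder} \<Rightarrow> real ^ 'k ^ 'k"
  where "Psi_hat X w y =
    (\<Sum>j = - (int CARD('n) - 1)..int CARD('n) - 1. w j *\<^sub>R Gamma_hat X y j)"

definition Omega_hat ::
  "real ^ 'k ^ 'n::{finite,linorder} \<Rightarrow> real ^ 'k ^ 'q \<Rightarrow> (int \<Rightarrow> real) \<Rightarrow> real ^ 'n::{finite,linorder} \<Rightarrow> real ^ 'q ^ 'q"
  where "Omega_hat X R w y = real CARD('n) *\<^sub>R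
    (R ** matrix_inv (transpose X ** X) ** Psi_hat X w y ** matrix_inv (transpose X ** X)
       ** transpose R)"

definition T_stat ::
  "real ^ 'k ^ 'n::{finite,linorder} \<Rightarrow> real ^ 'k ^ 'q \<Rightarrow> real ^ 'q \<Rightarrow> (int \<Rightarrow> real) \<Rightarrow> real ^ 'n::{finite,linorder} \<Rightarrow> real"
  where "T_stat X R r w y =
    (if det (Omega_hat X R w y) \<noteq> 0
     then (R *v beta_hat X y - r) \<bullet> (matrix_inv (Omega_hat X R w y) *v (R *v beta_hat X y - r))
     else 0)"

definition rejection_region ::
  "real ^ 'k ^ 'n::{finite,linorder} \<Rightarrow> real ^ 'k ^ 'q \<Rightarrow> real ^ 'q \<Rightarrow> (int \<Rightarrow> real) \<Rightarrow> real \<Rightarrow> (real ^ 'n::{finite,linorder}) set"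
  where "rejection_region X R r w C = {y. T_stat X R r w y \<ge> C}"

definition B_mat :: "real ^ 'k ^ 'n \<Rightarrow> real ^ 'k ^ 'q \<Rightarrow> real ^ 'n \<Rightarrow> real ^ 'n ^ 'q"
  where "B_mat X R y =
    R ** matrix_inv (transpose X ** X) ** transpose X ** diag_mat (u_hat X y)"

text \<open>
  The number of columns left after deletion is not a type, so the rank of
  \<open>R (X'X)\<^sup>-\<^sup>1 X'(\<not>(i\<^sub>1,\<dots>,i\<^sub>s))\<close> is written as the dimension of (the span of) its set of
  columns, i.e. of the vectors \<open>R (X'X)\<^sup>-\<^sup>1 c\<close> with \<open>c\<close> a non-deleted column of \<open>X'\<close>.
\<close>

definition rank_condition :: "real ^ 'k ^ 'n \<Rightarrow> real ^ 'k ^ 'q \<Rightarrow> bool"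
  where "rank_condition X R \<longleftrightarrow>
    dim {(R ** matrix_inv (transpose X ** X)) *v column i (transpose X) | i.
           axis i 1 \<notin> span (columns X)} = CARD('q)"

end

theory Submission
  imports Defs "HOL-Probability.Distributions"
begin

text \<open>
  Write \<open>T\<^sub>0\<close> for the test statistic with \<open>r = 0\<close>. For \<open>\<mu>\<^sub>0\<close> in the null hypothesis,
  \<open>T(\<mu>\<^sub>0 + z) = T\<^sub>0(z)\<close>, and \<open>T\<^sub>0(a z) = T\<^sub>0(z)\<close> for \<open>a \<noteq> 0\<close>: the test only sees the direction of
  \<open>y - \<mu>\<^sub>0\<close>. As \<open>\<rho> \<rightarrow> 1\<close> the matrix \<open>\<Lambda>(\<rho>)\<close> tends to the rank-one matrix \<open>e\<^sub>+ e\<^sub>+'\<close>, so the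
  direction of \<open>y - \<mu>\<^sub>0\<close> concentrates on the line through \<open>e\<^sub>+\<close>; as \<open>\<rho> \<rightarrow> -1\<close> it concentrates on
  the line through \<open>e\<^sub>-\<close>. Hence any open cone \<open>V\<close> that contains \<open>e\<^sub>+\<close> or \<open>e\<^sub>-\<close> catches
  \<open>y - \<mu>\<^sub>0\<close> with probability tending to one along a sequence in the model
  (\<open>model_concentrates\<close>). If the test rejects on \<open>V\<close> almost everywhere, its size is one
  (\<open>size_eq_1_if_cone_rejects\<close>); if it accepts on \<open>V\<close>, its rejection probabilities have infimum
  zero (\<open>power_eq_0_if_cone_accepts\<close>). Under the alternative the same holds because the mean
  either may approach \<open>\<mu>\<^sub>0\<close> or is drowned by a large \<open>\<sigma>\<close>.

  The concentration is a pathwise limit. The innovations representation of the stationary AR(1)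
  process is an explicit factorization \<open>\<Lambda>(\<rho>) = L(\<rho>) L(\<rho>)'\<close>, so that \<open>y = \<mu> + \<sigma> L(\<rho>) g\<close> with one
  standard Gaussian \<open>g\<close> for all \<open>\<rho>\<close>. The factor is continuous up to \<open>\<rho> = \<plusminus>1\<close>, where
  \<open>L(\<plusminus>1) g\<close> is \<open>\<plusminus>g\<^sub>1 e\<^sub>\<plusminus>\<close>, and dominated convergence of indicators finishes the argument.

  It remains to choose the cones. Everything rests on \<open>\<Omega>(y) = B(y) \<W> B(y)'\<close> with \<open>\<W>\<close> the positive
  definite weight matrix: \<open>\<Omega>(y)\<close> is nonsingular exactly if \<open>B(y)\<close> has rank \<open>q\<close>, and there \<open>T\<close> is
  continuous. If \<open>B(e)\<close> has rank \<open>q\<close>, the cone is \<open>{T\<^sub>0 > C}\<close> or \<open>{T\<^sub>0 < C}\<close>, within the nonsingular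
  points. If \<open>B(e) = 0\<close>, then \<open>\<Omega>\<close> is small near \<open>e\<close> while \<open>b = R \<beta>(z)\<close> is not, and Cauchy-Schwarz,
  \<open>(b'b)\<^sup>2 \<le> (b'\<Omega>b)(b'\<Omega>\<^sup>-\<^sup>1b)\<close>, shows that \<open>T\<^sub>0 > C\<close> on \<open>{C b'\<Omega>b < (b'b)\<^sup>2}\<close> as far as \<open>\<Omega>\<close> is nonsingular
  there. The rank condition makes the singular points a null set (\<open>AE_Omega_hat_nonsingular\<close>).
  Finally, the test is biased because \<open>T\<close> is unbounded (\<open>T_stat_unbounded\<close>), which makes its size
  positive when its infimal power is zero.
\<close>


section \<open>Matrices and positive definite forms\<close>

lemma matrix_inv_cancel:
  fixes A :: "real ^ 'm ^ 'm"
  assumes "det A \<noteq> 0"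
  shows "A ** matrix_inv A = mat 1" "matrix_inv A ** A = mat 1"
proof -
  have "\<exists>A'. A ** A' = mat 1 \<and> A' ** A = mat 1"
    using assms invertible_det_nz[of A] unfolding invertible_def by blast
  then have "A ** matrix_inv A = mat 1 \<and> matrix_inv A ** A = mat 1"
    unfolding matrix_inv_def by (rule someI_ex)
  then show "A ** matrix_inv A = mat 1" "matrix_inv A ** A = mat 1" by blast+
qed

lemma matrix_inv_unique:
  fixes A :: "real ^ 'm ^ 'm"
  assumes "A ** B = mat 1"
  shows "matrix_inv A = B"
proof -
  have "det A * det B = 1" using assms by (metis det_mul det_I)
  then have "det A \<noteq> 0" by auto
  then show ?thesis
    by (metis assms matrix_inv_cancel(2) matrix_mul_assoc matrix_mul_lid matrix_mul_rid)
qed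

lemma matrix_inv_solves:
  fixes A :: "real ^ 'm ^ 'm"
  assumes "det A \<noteq> 0"
  shows "matrix_inv A *v b = x \<longleftrightarrow> A *v x = b"
  using matrix_inv_cancel[OF assms] by (metis matrix_vector_mul_assoc matrix_vector_mul_lid)

lemma inner_matrix_transpose:
  fixes A :: "real ^ 'm ^ 'n"
  shows "x \<bullet> (A *v y) = (transpose A *v x) \<bullet> y"
  by (metis dot_lmul_matrix vector_transpose_matrix transpose_transpose)

lemma det_nonzero_iff_injective:
  fixes A :: "real ^ 'm ^ 'm"
  shows "det A \<noteq> 0 \<longleftrightarrow> (\<forall>x. A *v x = 0 \<longrightarrow> x = 0)"
  using invertible_det_nz[of A] matrix_left_invertible_ker[of A]
  by (metis invertible_def invertible_left_inverse)

lemma sym_posdef_scaleR: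
  assumes "sym_posdef A" "c > 0"
  shows "sym_posdef (c *\<^sub>R A)"
  using assms unfolding sym_posdef_def
  by (auto simp: scaleR_matrix_vector_assoc[symmetric] transpose_def vec_eq_iff)

lemma sym_posdef_det_nonzero:
  assumes "sym_posdef A"
  shows "det A \<noteq> 0"
  using assms unfolding det_nonzero_iff_injective sym_posdef_def
  by (metis inner_zero_right less_irrefl)

text \<open>
  A maximal orthonormal system for the inner product \<open>x' \<Phi> y\<close> is a basis: otherwise Gram-Schmidt
  would extend it. With \<open>B\<close> the matrix of that basis, \<open>B' \<Phi> B = I\<close>, and \<open>A = (B')\<^sup>-\<^sup>1\<close> is the
  required factor. Every Gaussian measure is thereby an affine image of the standard one.
\<close>
lemma sym_posdef_factor:
  fixes \<Phi> :: "real ^ 'n ^ 'n"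
  assumes "sym_posdef \<Phi>"
  obtains A :: "real ^ 'n ^ 'n" where "\<Phi> = A ** transpose A"
proof -
  define ip where "ip x y = x \<bullet> (\<Phi> *v y)" for x y
  have sym: "ip x y = ip y x" for x y
    using assms unfolding ip_def sym_posdef_def by (metis inner_matrix_transpose inner_commute)
  have pos: "ip x x > 0" if "x \<noteq> 0" for x
    using assms that unfolding ip_def sym_posdef_def by blast
  have lin: "linear (ip x)" for x
    unfolding ip_def by (intro linearI) (auto simp: algebra_simps matrix_vector_mult_scaleR)
  define orth where "orth S \<longleftrightarrow> finite S \<and> (\<forall>x\<in>S. \<forall>y\<in>S. ip x y = (if x = y then 1 else 0))" for S
  have coeff: "ip x (\<Sum>y\<in>S. c y *\<^sub>R y) = (if x \<in> S then c x else 0)"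
    if "orth S" "x \<in> S" for S c x
  proof -
    have "ip x (\<Sum>y\<in>S. c y *\<^sub>R y) = (\<Sum>y\<in>S. c y * ip x y)"
      by (simp add: linear_sum[OF lin] linear_scale[OF lin] o_def)
    also have "\<dots> = (\<Sum>y\<in>S. if x = y then c y else 0)"
      by (rule sum.cong) (use that in \<open>auto simp: orth_def\<close>)
    finally show ?thesis using that by (simp add: orth_def)
  qed
  have indep: "independent S" if "orth S" for S
  proof -
    have fin: "finite S" using that by (simp add: orth_def)
    show ?thesis
      unfolding dependent_finite[OF fin]
    proof clarify
      fix u v assume "(\<Sum>v\<in>S. u v *\<^sub>R v) = 0" "v \<in> S" "u v \<noteq> 0"
      then show False using coeff[OF that, of v u] linear_0[OF lin, of v] by simp
    qed
  qed
  have card_le: "card S \<le> CARD('n)" if "orth S" for S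
    using independent_card_le[OF indep[OF that]] by simp
  have "\<exists>S. orth S \<and> (\<forall>S'. orth S' \<longrightarrow> card S' \<le> card S)"
    by (rule ex_has_greatest_nat[of orth "{}" card "Suc CARD('n)"])
       (use card_le in \<open>auto simp: orth_def le_less_Suc_eq less_Suc_eq_le\<close>)
  then obtain S where S: "orth S" and max: "\<And>S'. orth S' \<Longrightarrow> card S' \<le> card S" by blast
  have fin: "finite S" using S by (simp add: orth_def)
  have span: "span S = UNIV"
  proof (rule ccontr)
    assume "span S \<noteq> UNIV"
    then obtain x where x: "x \<notin> span S" by blast
    define z where "z = x - (\<Sum>y\<in>S. ip y x *\<^sub>R y)"
    have zS: "z \<notin> span S"
      using x unfolding z_def
      by (metis (no_types, lifting) diff_add_cancel span_add span_base span_scale span_sum)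
    then have z0: "z \<noteq> 0" using span_zero by metis
    have orthz: "ip y z = 0" if "y \<in> S" for y
      unfolding z_def using coeff[OF S that, of "\<lambda>y. ip y x"] that by (simp add: linear_diff[OF lin])
    define z' where "z' = (1 / sqrt (ip z z)) *\<^sub>R z"
    have "z' \<notin> span S" using zS pos[OF z0] unfolding z'_def
      by (metis divide_eq_0_iff less_irrefl one_neq_zero real_sqrt_eq_0_iff span_scale scaleR_scaleR
          left_inverse scaleR_one)
    then have new: "z' \<notin> S" using span_base by metis
    have "ip z' z' = 1" using pos[OF z0]
      by (simp add: z'_def linear_scale[OF lin] sym[of "_ *\<^sub>R z" z])
    moreover have "ip y z' = 0" if "y \<in> S" for y
      using orthz[OF that] by (simp add: z'_def linear_scale[OF lin])
    ultimately have "orth (insert z' S)" using S new sym unfolding orth_def by auto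
    from max[OF this] show False using new fin by simp
  qed
  have "card S = CARD('n)"
    using dim_span_eq_card_independent[OF indep[OF S]] span by simp
  then obtain b where b: "bij_betw b (UNIV :: 'n set) S"
    using fin finite_same_card_bij[of "UNIV :: 'n set" S] by auto
  define B :: "real ^ 'n ^ 'n" where "B = (\<chi> i j. b j $ i)"
  have "(transpose B ** (\<Phi> ** B)) $ i $ j = ip (b i) (b j)" for i j
    by (simp add: ip_def B_def matrix_matrix_mult_def transpose_def inner_vec_def matrix_vector_mult_def)
  moreover have "ip (b i) (b j) = (if i = j then 1 else 0)" for i j
    using S b unfolding orth_def bij_betw_def inj_on_def by (metis UNIV_I image_eqI)
  ultimately have "transpose B ** (\<Phi> ** B) = mat 1" by (simp add: vec_eq_iff mat_def)
  moreover from this have dB: "det B \<noteq> 0" by (metis det_I det_mul det_transpose mult_zero_left zero_neq_one)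
  ultimately have "\<Phi> = matrix_inv (transpose B) ** matrix_inv B"
    by (metis (no_types, opaque_lifting) det_transpose matrix_inv_cancel matrix_mul_assoc matrix_mul_lid matrix_mul_rid)
  moreover have "matrix_inv (transpose B) = transpose (matrix_inv B)"
    by (metis dB matrix_inv_cancel(2) matrix_inv_unique matrix_transpose_mul transpose_mat)
  ultimately show thesis using that[of "transpose (matrix_inv B)"] by (simp add: transpose_transpose)
qed


section \<open>Lebesgue measure under linear maps\<close>

lemma borel_measurable_linear:
  fixes f :: "'a::euclidean_space \<Rightarrow> 'b::real_normed_vector"
  assumes "linear f"
  shows "f \<in> borel_measurable borel"
  using assms by (intro borel_measurable_continuous_onI linear_continuous_on) (simp add: linear_conv_bounded_linear)

lemma prod_Basis_vec:
  fixes x :: "real ^ 'n"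
  shows "(\<Prod>b\<in>Basis. x \<bullet> b) = (\<Prod>i\<in>UNIV. x $ i)"
  by (simp add: Basis_vec_def UNION_singleton_eq_range prod.reindex inj_on_def axis_eq_axis inner_axis)

text \<open>
  For a box whose lower corner has nonnegative \<open>n\<close>-th coordinate this is
  \<open>measure_shear_interval\<close>; a translation moves any box there, and boxes suffice for a linear map.
\<close>
lemma measure_lebesgue_shear:
  fixes m n :: "'n::finite"
  assumes "m \<noteq> n" and S: "S \<in> lmeasurable"
  defines "h \<equiv> \<lambda>x :: real ^ 'n. \<chi> i. if i = m then x $ m + x $ n else x $ i"
  shows "measure lebesgue (h ` S) = measure lebesgue S"
proof -
  have lin: "linear h"
    unfolding h_def by (rule linearI) (auto simp: vec_eq_iff algebra_simps)
  have "measure lebesgue (h ` cbox a b) = measure lebesgue (cbox a b)" for a b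
  proof (cases "cbox a b = {}")
    case False
    \<comment> \<open>the shift that makes the lower corner vanish in coordinate \<open>n\<close>\<close>
    define v :: "real ^ 'n" where "v = axis n (- a $ n)"
    have "measure lebesgue (h ` cbox a b) = measure lebesgue ((+) (h v) ` h ` cbox a b)"
      by (rule measure_translation[symmetric])
    also have "(+) (h v) ` h ` cbox a b = h ` cbox (v + a) (v + b)"
      by (simp add: cbox_translation image_comp o_def linear_add[OF lin])
    also have "measure lebesgue \<dots> = measure lebesgue (cbox (v + a) (v + b))"
      unfolding h_def
      by (rule measure_shear_interval) (use assms(1) False in \<open>auto simp: v_def cbox_translation\<close>)
    also have "\<dots> = measure lebesgue (cbox a b)"
      by (simp only: cbox_translation measure_translation)
    finally show ?thesis .
  qed simp
  from measure_linear_sufficient[OF lin S, of 1] this show ?thesis by simp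
qed

lemma lborel_distr_shear:
  fixes m n :: "'n::finite"
  assumes "m \<noteq> n"
  shows "lborel = distr lborel borel (\<lambda>x :: real ^ 'n. \<chi> i. if i = m then x $ m + x $ n else x $ i)"
    (is "_ = distr _ _ ?h")
proof (rule lborel_eqI)
  fix l u :: "real ^ 'n"
  assume lu: "\<And>b. b \<in> Basis \<Longrightarrow> l \<bullet> b \<le> u \<bullet> b"
  let ?k = "\<lambda>x :: real ^ 'n. \<chi> i. if i = m then x $ m - x $ n else x $ i"
  have lin: "linear ?h" "linear ?k" by (auto intro!: linearI simp: vec_eq_iff algebra_simps)
  have hm: "?h \<in> borel_measurable borel"
    by (rule borel_measurable_linear[OF lin(1)])
  have hk: "?h (?k x) = x" "?k (?h x) = x" for x using assms by (auto simp: vec_eq_iff)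
  define S where "S = ?h -` box l u"
  have S_eq: "S = ?k ` box l u" unfolding S_def
  proof (intro set_eqI iffI)
    fix x assume "x \<in> ?h -` box l u"
    then have "?k (?h x) \<in> ?k ` box l u" by (intro imageI) (rule vimageD)
    then show "x \<in> ?k ` box l u" by (simp only: hk(2))
  next
    fix x assume "x \<in> ?k ` box l u"
    then obtain y where y: "x = ?k y" "y \<in> box l u" by blast
    show "x \<in> ?h -` box l u" unfolding vimage_eq y(1) hk(1) by (rule y(2))
  qed
  have hS: "?h ` S = box l u" unfolding S_eq image_comp o_def hk by simp
  have borel: "S \<in> sets borel" using measurable_sets[OF hm, of "box l u"] by (simp add: S_def)
  have lmeas: "S \<in> lmeasurable"
  proof (rule fmeasurableI2)
    show "?k ` cbox l u \<in> lmeasurable" by (rule measurable_linear_image_interval[OF lin(2)])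
    show "S \<subseteq> ?k ` cbox l u" unfolding S_eq by (intro image_mono box_subset_cbox)
    show "S \<in> sets lebesgue" using borel by simp
  qed
  have "measure lebesgue S = measure lebesgue (box l u)"
    using measure_lebesgue_shear[OF assms lmeas] by (simp only: hS)
  moreover have "emeasure lebesgue S = measure lebesgue S"
    by (rule emeasure_eq_measure2[OF lmeas])
  ultimately have "emeasure lborel S = measure lborel (box l u)" using borel by simp
  then show "emeasure (distr lborel borel ?h) (box l u) = (\<Prod>b\<in>Basis. (u - l) \<bullet> b)"
    using hm lu by (simp add: emeasure_distr S_def)
qed simp

lemma lborel_distr_swap:
  fixes m n :: "'n::finite"
  shows "lborel = distr lborel borel (\<lambda>x :: real ^ 'n. \<chi> i. x $ Transposition.transpose m n i)"
    (is "_ = distr _ _ ?h")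
proof (rule lborel_eqI)
  fix l u :: "real ^ 'n"
  assume lu: "\<And>b. b \<in> Basis \<Longrightarrow> l \<bullet> b \<le> u \<bullet> b"
  have lin: "linear ?h" by (auto intro!: linearI simp: vec_eq_iff algebra_simps)
  have hm: "?h \<in> borel_measurable borel"
    by (rule borel_measurable_linear[OF lin])
  have vimage: "?h -` box l u = box (?h l) (?h u)"
    by (auto simp: mem_box_cart) (metis transpose_involutory)+
  have le: "l $ i \<le> u $ i" for i using lu[of "axis i 1"] by (auto simp: Basis_vec_def inner_axis)
  have "(\<Prod>b\<in>Basis. (?h u - ?h l) \<bullet> b) = (\<Prod>i\<in>UNIV. (u - l) $ Transposition.transpose m n i)"
    by (simp only: prod_Basis_vec) simp
  also have "\<dots> = (\<Prod>b\<in>Basis. (u - l) \<bullet> b)"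
    unfolding prod_Basis_vec
    by (rule prod.permute[OF permutes_swap_id, unfolded o_def, symmetric]) simp_all
  finally have eq: "(\<Prod>b\<in>Basis. (?h u - ?h l) \<bullet> b) = (\<Prod>b\<in>Basis. (u - l) \<bullet> b)" .
  have "emeasure lborel (box (?h l) (?h u)) = (\<Prod>b\<in>Basis. (?h u - ?h l) \<bullet> b)"
    by (rule emeasure_lborel_box) (use le in \<open>auto simp: Basis_vec_def inner_axis\<close>)
  then show "emeasure (distr lborel borel ?h) (box l u) = (\<Prod>b\<in>Basis. (u - l) \<bullet> b)"
    unfolding eq by (subst emeasure_distr) (simp_all add: hm vimage del: emeasure_lborel_box)
qed simp

text \<open>
  Every linear map is a composition of elementary ones, and both sides are multiplicative. Swaps and
  shears preserve the measure, diagonal maps rescale it coordinatewise. A regular composition has regular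
  factors, so singular elementary maps can be ignored.
\<close>
lemma lborel_distr_linear:
  fixes f :: "real ^ 'n \<Rightarrow> real ^ 'n"
  assumes "linear f" "det (matrix f) \<noteq> 0"
  shows "lborel = density (distr lborel borel f) (\<lambda>_. ennreal \<bar>det (matrix f)\<bar>)"
proof -
  define P where "P f \<longleftrightarrow>
    (det (matrix f) \<noteq> 0 \<longrightarrow> lborel = density (distr lborel borel f) (\<lambda>_. ennreal \<bar>det (matrix f)\<bar>))"
    for f :: "real ^ 'n \<Rightarrow> real ^ 'n"
  have preserving: "P h" if "lborel = distr lborel borel h" "\<bar>det (matrix h)\<bar> = 1" for h
    using that by (simp add: P_def density_1)
  have "P f"
  proof (rule induct_linear_elementary[OF assms(1)])
    fix f g :: "real ^ 'n \<Rightarrow> real ^ 'n"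
    assume lin: "linear f" "linear g" and P: "P f" "P g"
    have [measurable]: "f \<in> borel_measurable borel" "g \<in> borel_measurable borel"
      by (rule borel_measurable_linear; fact)+
    have det: "det (matrix (f \<circ> g)) = det (matrix f) * det (matrix g)"
      by (simp add: matrix_compose[OF lin(2,1)] det_mul)
    show "P (f \<circ> g)"
      unfolding P_def
    proof
      assume "det (matrix (f \<circ> g)) \<noteq> 0"
      then have f: "lborel = density (distr lborel borel f) (\<lambda>_. ennreal \<bar>det (matrix f)\<bar>)"
        and g: "lborel = density (distr lborel borel g) (\<lambda>_. ennreal \<bar>det (matrix g)\<bar>)"
        using P det by (auto simp: P_def)
      have "distr lborel borel f = density (distr (distr lborel borel g) borel f) (\<lambda>_. ennreal \<bar>det (matrix g)\<bar>)"
        by (subst g) (simp add: density_distr)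
      also have "distr (distr lborel borel g) borel f = distr lborel borel (f \<circ> g)"
        by (simp add: distr_distr)
      finally have "lborel = density (density (distr lborel borel (f \<circ> g)) (\<lambda>_. ennreal \<bar>det (matrix g)\<bar>))
          (\<lambda>_. ennreal \<bar>det (matrix f)\<bar>)"
        using f by simp
      then show "lborel = density (distr lborel borel (f \<circ> g)) (\<lambda>_. ennreal \<bar>det (matrix (f \<circ> g))\<bar>)"
        by (simp add: density_density_eq det abs_mult ennreal_mult' mult.commute)
    qed
  next
    fix f :: "real ^ 'n \<Rightarrow> real ^ 'n" and i
    assume "linear f" "\<And>x. f x $ i = 0"
    then have "row i (matrix f) = 0" by (simp add: row_def matrix_def vec_eq_iff)
    then show "P f" by (simp add: P_def det_zero_row)
  next
    fix c :: "'n \<Rightarrow> real"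
    let ?h = "\<lambda>x :: real ^ 'n. \<chi> i. c i * x $ i"
    have "matrix ?h = (\<chi> i j. if i = j then c i else 0)"
      by (auto simp: matrix_def axis_def vec_eq_iff)
    then have det: "det (matrix ?h) = (\<Prod>i\<in>UNIV. c i)"
      by (simp add: det_diagonal)
    show "P ?h"
      unfolding P_def
    proof
      assume "det (matrix ?h) \<noteq> 0"
      then have c: "c i \<noteq> 0" for i by (simp add: det)
      define d where "d b = (\<chi> i. c i) \<bullet> b" for b :: "real ^ 'n"
      have d: "d (axis i 1) = c i" for i by (simp add: d_def inner_axis)
      have "(\<lambda>x. 0 + (\<Sum>j\<in>Basis. (d j * (x \<bullet> j)) *\<^sub>R j)) = ?h"
      proof
        fix x
        have "(\<Sum>j\<in>Basis. (d j * (x \<bullet> j)) *\<^sub>R j) = (\<Sum>i\<in>UNIV. (c i * x $ i) *\<^sub>R axis i 1)"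
          by (simp add: Basis_vec_def UNION_singleton_eq_range sum.reindex inj_on_def axis_eq_axis d inner_axis)
        also have "\<dots> = ?h x" by (simp add: vec_eq_iff axis_def if_distrib cong: if_cong)
        finally show "0 + (\<Sum>j\<in>Basis. (d j * (x \<bullet> j)) *\<^sub>R j) = ?h x" by simp
      qed
      moreover have "(\<Prod>j\<in>Basis. \<bar>d j\<bar>) = \<bar>det (matrix ?h)\<bar>"
        unfolding det abs_prod
        by (simp add: d Basis_vec_def UNION_singleton_eq_range prod.reindex inj_on_def axis_eq_axis)
      moreover have "d j \<noteq> 0" if "j \<in> Basis" for j using that c by (auto simp: Basis_vec_def d)
      ultimately show "lborel = density (distr lborel borel ?h) (\<lambda>_. ennreal \<bar>det (matrix ?h)\<bar>)"
        using lborel_affine_euclidean[of d 0] by simp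
    qed
  next
    fix m n :: 'n
    assume "m \<noteq> n"
    let ?h = "\<lambda>x :: real ^ 'n. \<chi> i. x $ Transposition.transpose m n i"
    have lin: "linear ?h" by (auto intro!: linearI simp: vec_eq_iff)
    have "?h \<circ> ?h = id" by (auto simp: vec_eq_iff fun_eq_iff)
    then have "det (matrix ?h) * det (matrix ?h) = 1"
      using matrix_compose[OF lin lin] by (metis det_mul det_I matrix_id_mat_1)
    then have "\<bar>det (matrix ?h)\<bar> = 1" by (simp only: abs_square_eq_1[symmetric] power2_eq_square)
    then show "P ?h" by (rule preserving[OF lborel_distr_swap])
  next
    fix m n :: 'n
    assume mn: "m \<noteq> n"
    let ?h = "\<lambda>x :: real ^ 'n. \<chi> i. if i = m then x $ m + x $ n else x $ i"
    have "matrix ?h = (\<chi> k. if k = m then row m (mat 1) + 1 *s row n (mat 1) else row k (mat 1))"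
      by (auto simp: matrix_def row_def mat_def axis_def vec_eq_iff)
    then have "det (matrix ?h) = 1" using det_row_operation[OF mn, of "mat 1 :: real ^ 'n ^ 'n" 1] by simp
    then show "P ?h" by (intro preserving[OF lborel_distr_shear[OF mn]]) simp
  qed
  then show ?thesis using assms(2) by (simp add: P_def)
qed

lemma lborel_affine_matrix:
  fixes A :: "real ^ 'n ^ 'n"
  assumes "det A \<noteq> 0"
  shows "lborel = density (distr lborel borel (\<lambda>g. \<mu> + A *v g)) (\<lambda>_. ennreal \<bar>det A\<bar>)"
proof -
  have A: "(*v) A \<in> borel_measurable borel"
    by (rule borel_measurable_linear) (rule matrix_vector_mul_linear)
  note [measurable] = A
  have "lborel = distr lborel borel (\<lambda>y. \<mu> + y)" by (rule lborel_distr_plus[symmetric])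
  also have "\<dots> = distr (density (distr lborel borel ((*v) A)) (\<lambda>_. ennreal \<bar>det A\<bar>)) borel (\<lambda>y. \<mu> + y)"
    using lborel_distr_linear[OF matrix_vector_mul_linear[of A]] assms by simp
  also have "\<dots> = density (distr (distr lborel borel ((*v) A)) borel (\<lambda>y. \<mu> + y)) (\<lambda>_. ennreal \<bar>det A\<bar>)"
    by (rule density_distr[symmetric]) auto
  also have "distr (distr lborel borel ((*v) A)) borel (\<lambda>y. \<mu> + y) = distr lborel borel (\<lambda>g. \<mu> + A *v g)"
    by (subst distr_distr) (auto simp: o_def)
  finally show ?thesis .
qed


section \<open>Gaussian measures\<close>

definition std_gaussian :: "(real ^ 'n) measure"
  where "std_gaussian = density lborel (\<lambda>g. ennreal (\<Prod>b\<in>Basis. std_normal_density (g \<bullet> b)))"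

lemma sets_std_gaussian [simp, measurable_cong]: "sets std_gaussian = sets borel"
  by (simp add: std_gaussian_def)

lemma space_std_gaussian [simp]: "space std_gaussian = UNIV"
  by (simp add: std_gaussian_def)

lemma prob_space_std_gaussian: "prob_space (std_gaussian :: (real ^ 'n) measure)"
proof
  have one: "(\<integral>\<^sup>+x. ennreal (std_normal_density x) \<partial>lborel) = 1"
    using prob_space.emeasure_space_1[OF prob_space_normal_density[of 1 0]]
    by (simp add: emeasure_density)
  have "emeasure (std_gaussian :: (real ^ 'n) measure) (space std_gaussian) =
    (\<integral>\<^sup>+g. (\<Prod>b\<in>(Basis :: (real ^ 'n) set). ennreal (std_normal_density (g \<bullet> b))) \<partial>lborel)"
    by (simp add: std_gaussian_def emeasure_density prod_ennreal)
  also have "\<dots> = (\<Prod>b\<in>(Basis :: (real ^ 'n) set). \<integral>\<^sup>+x. ennreal (std_normal_density x) \<partial>lborel)"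
    by (rule nn_integral_lborel_prod) auto
  finally show "emeasure (std_gaussian :: (real ^ 'n) measure) (space std_gaussian) = 1"
    by (simp add: one)
qed

lemma std_gaussian_density:
  fixes g :: "real ^ 'n"
  shows "(\<Prod>b\<in>Basis. std_normal_density (g \<bullet> b)) = exp (- (g \<bullet> g) / 2) / sqrt ((2 * pi) ^ CARD('n))"
proof -
  have "(\<Prod>b\<in>Basis. std_normal_density (g \<bullet> b)) =
    (\<Prod>b\<in>(Basis :: (real ^ 'n) set). 1 / sqrt (2 * pi)) * (\<Prod>b\<in>Basis. exp (- (g \<bullet> b)\<^sup>2 / 2))"
    unfolding std_normal_density_def by (rule prod.distrib)
  also have "(\<Prod>b\<in>Basis. exp (- (g \<bullet> b)\<^sup>2 / 2)) = exp (\<Sum>b\<in>Basis. - (g \<bullet> b)\<^sup>2 / 2)"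
    by (simp add: exp_sum)
  also have "(\<Sum>b\<in>Basis. - (g \<bullet> b)\<^sup>2 / 2) = - (g \<bullet> g) / 2"
    by (subst euclidean_inner[of g g]) (simp add: sum_negf sum_divide_distrib power2_eq_square)
  also have "(\<Prod>b\<in>(Basis :: (real ^ 'n) set). 1 / sqrt (2 * pi)) = 1 / sqrt ((2 * pi) ^ CARD('n))"
    by (simp add: power_one_over real_sqrt_power real_sqrt_mult power_mult_distrib)
  finally show ?thesis by simp
qed

lemma continuous_on_matrix_vector_mult [continuous_intros]:
  fixes A :: "'a::topological_space \<Rightarrow> real ^ 'm ^ 'n"
  assumes "continuous_on S A" "continuous_on S f"
  shows "continuous_on S (\<lambda>x. A x *v f x)"
  unfolding matrix_vector_mult_def using assms by (intro continuous_intros)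

lemma borel_measurable_matrix_vector_mult [measurable (raw)]:
  fixes A :: "real ^ 'm ^ 'n"
  assumes "f \<in> borel_measurable M"
  shows "(\<lambda>g. A *v f g) \<in> borel_measurable M"
  by (rule borel_measurable_continuous_on[OF _ assms]) (intro continuous_intros)

lemma borel_measurable_gaussian_density [measurable]:
  fixes \<Phi> :: "real ^ 'n ^ 'n"
  shows "(\<lambda>y. ennreal (exp (- ((y - \<mu>) \<bullet> (matrix_inv \<Phi> *v (y - \<mu>))) / 2) / sqrt ((2 * pi) ^ CARD('n) * det \<Phi>)))
    \<in> borel_measurable lborel"
  by measurable

text \<open>
  Change of variables \<open>y = \<mu> + A g\<close>: the Jacobian \<open>\<bar>det A\<bar>\<close> cancels \<open>sqrt (det \<Phi>)\<close> and the quadratic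
  form \<open>(A g)' \<Phi>\<^sup>-\<^sup>1 (A g)\<close> becomes \<open>g' g\<close>.
\<close>
lemma gaussian_eq_distr:
  fixes A :: "real ^ 'n ^ 'n"
  assumes \<Phi>: "\<Phi> = A ** transpose A" and det: "det \<Phi> \<noteq> 0"
  shows "gaussian \<mu> \<Phi> = distr std_gaussian borel (\<lambda>g. \<mu> + A *v g)"
proof -
  define f :: "real ^ 'n \<Rightarrow> real" where
    "f = (\<lambda>y. exp (- ((y - \<mu>) \<bullet> (matrix_inv \<Phi> *v (y - \<mu>))) / 2) / sqrt ((2 * pi) ^ CARD('n) * det \<Phi>))"
  have det\<Phi>: "det \<Phi> = (det A)\<^sup>2" by (simp add: \<Phi> det_mul power2_eq_square)
  with det have detA: "det A \<noteq> 0" by auto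
  have f_meas [measurable]: "f \<in> borel_measurable borel"
    unfolding f_def by measurable
  have quad: "(A *v g) \<bullet> (matrix_inv \<Phi> *v (A *v g)) = g \<bullet> g" for g
  proof -
    obtain x where x: "transpose A *v x = g"
      using matrix_inv_solves[of "transpose A" g] detA by auto
    have "matrix_inv \<Phi> *v (A *v g) = x"
      unfolding matrix_inv_solves[OF det] using x by (simp add: \<Phi> flip: matrix_vector_mul_assoc)
    then show ?thesis using x by (simp add: inner_matrix_transpose inner_commute)
  qed
  have eq: "\<bar>det A\<bar> * f (\<mu> + A *v g) = (\<Prod>b\<in>Basis. std_normal_density (g \<bullet> b))" for g
    unfolding std_gaussian_density using detA by (simp add: f_def quad det\<Phi> real_sqrt_mult)
  have "gaussian \<mu> \<Phi> = density lborel f" by (simp add: gaussian_def f_def)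
  also have "\<dots> = density (density (distr lborel borel (\<lambda>g. \<mu> + A *v g)) (\<lambda>_. ennreal \<bar>det A\<bar>)) f"
    using lborel_affine_matrix[OF detA, of \<mu>] by simp
  also have "\<dots> = density (distr lborel borel (\<lambda>g. \<mu> + A *v g)) (\<lambda>y. ennreal \<bar>det A\<bar> * ennreal (f y))"
    by (rule density_density_eq) measurable
  also have "\<dots> = distr (density lborel (\<lambda>g. ennreal \<bar>det A\<bar> * ennreal (f (\<mu> + A *v g)))) borel (\<lambda>g. \<mu> + A *v g)"
    by (rule density_distr) measurable
  also have "(\<lambda>g. ennreal \<bar>det A\<bar> * ennreal (f (\<mu> + A *v g))) = (\<lambda>g. ennreal (\<Prod>b\<in>Basis. std_normal_density (g \<bullet> b)))"
    unfolding eq[symmetric] by (simp add: ennreal_mult')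
  finally show ?thesis by (simp add: std_gaussian_def)
qed

lemma sets_gaussian [simp, measurable_cong]: "sets (gaussian \<mu> \<Phi>) = sets borel"
  by (simp add: gaussian_def)

lemma space_gaussian [simp]: "space (gaussian \<mu> \<Phi>) = UNIV"
  by (simp add: gaussian_def)

lemma prob_space_gaussian:
  fixes \<Phi> :: "real ^ 'n ^ 'n"
  assumes "sym_posdef \<Phi>"
  shows "prob_space (gaussian \<mu> \<Phi>)"
proof -
  obtain A :: "real ^ 'n ^ 'n" where "\<Phi> = A ** transpose A" by (rule sym_posdef_factor[OF assms])
  from gaussian_eq_distr[OF this sym_posdef_det_nonzero[OF assms]]
  have "gaussian \<mu> \<Phi> = distr std_gaussian borel (\<lambda>g. \<mu> + A *v g)" .
  moreover have "(\<lambda>g. \<mu> + A *v g) \<in> measurable std_gaussian borel" by measurable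
  ultimately show ?thesis
    using prob_space.prob_space_distr[OF prob_space_std_gaussian, of "\<lambda>g. \<mu> + A *v g" borel] by simp
qed

lemma AE_lborel_hyperplane:
  fixes c :: "real ^ 'n"
  assumes "c \<noteq> 0"
  shows "AE y in lborel. c \<bullet> y \<noteq> 0"
proof -
  have "{y. c \<bullet> y = 0} \<in> null_sets lborel"
    using negligible_hyperplane[of c 0] assms
    by (simp add: negligible_iff_null_sets null_sets_completion_iff borel_closed closed_hyperplane)
  then show ?thesis by (rule AE_I') auto
qed

lemma AE_gaussian_if_AE_lborel:
  fixes \<Phi> :: "real ^ 'n ^ 'n"
  assumes "AE y in lborel. P y"
  shows "AE y in gaussian \<mu> \<Phi>. P y"
proof -
  have "(\<lambda>y. ennreal (exp (- ((y - \<mu>) \<bullet> (matrix_inv \<Phi> *v (y - \<mu>))) / 2) / sqrt ((2 * pi) ^ CARD('n) * det \<Phi>)))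
    \<in> borel_measurable (lborel :: (real ^ 'n) measure)"
    by (rule borel_measurable_gaussian_density)
  then show ?thesis unfolding gaussian_def using assms by (subst AE_density) auto
qed

text \<open>
  The density is positive everywhere and a nonempty open set is not Lebesgue null.
\<close>
lemma measure_gaussian_open_pos:
  fixes \<Phi> :: "real ^ 'n ^ 'n"
  assumes "sym_posdef \<Phi>" "open U" "U \<noteq> {}"
  shows "measure (gaussian \<mu> \<Phi>) U > 0"
proof (rule ccontr)
  assume "\<not> ?thesis"
  interpret prob_space "gaussian \<mu> \<Phi>" by (rule prob_space_gaussian) fact
  from \<open>\<not> ?thesis\<close> have zero: "emeasure (gaussian \<mu> \<Phi>) U = 0"
    using measure_nonneg[of "gaussian \<mu> \<Phi>" U] by (simp add: emeasure_eq_measure)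
  obtain A :: "real ^ 'n ^ 'n" where A: "\<Phi> = A ** transpose A" by (rule sym_posdef_factor[OF assms(1)])
  have "det \<Phi> > 0" 
    using sym_posdef_det_nonzero[OF assms(1)] by (auto simp: A det_mul zero_less_mult_iff linorder_neq_iff)
  let ?f = "\<lambda>y. exp (- ((y - \<mu>) \<bullet> (matrix_inv \<Phi> *v (y - \<mu>))) / 2) / sqrt ((2 * pi) ^ CARD('n) * det \<Phi>)"
  have meas: "(\<lambda>y. ennreal (?f y)) \<in> borel_measurable lborel"
    by (rule borel_measurable_gaussian_density)
  have "(\<integral>\<^sup>+y. ennreal (?f y) * indicator U y \<partial>lborel) = 0"
    using zero assms(2) emeasure_density[OF meas, of U] by (simp add: gaussian_def)
  then have ae: "AE y in lborel. ennreal (?f y) * indicator U y = 0"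
    using assms(2) meas by (subst (asm) nn_integral_0_iff_AE) auto
  have "?f y > 0" for y using \<open>det \<Phi> > 0\<close> by simp
  then have "ennreal (?f y) \<noteq> 0" for y by (simp only: ennreal_eq_0_iff not_le)
  with ae have "AE y in lborel. y \<notin> U" by (auto simp only: mult_eq_0_iff indicator_eq_0_iff)
  then have "U \<in> null_sets lborel" using assms(2) by (simp add: AE_iff_null_sets)
  then have "negligible U" by (simp add: negligible_iff_null_sets null_sets_completionI)
  with open_not_negligible[OF assms(2,3)] show False by simp
qed

text \<open>
  The same \<open>g\<close> serves all \<open>j\<close>. For almost every \<open>g\<close> the points \<open>m j + A j g\<close> converge to a
  point of the open set \<open>V\<close> and hence are eventually in \<open>V\<close>; dominated convergence applies to the
  indicators. Singular \<open>A0\<close> is the case of interest.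
\<close>
lemma std_gaussian_affine_tendsto_1:
  fixes m :: "nat \<Rightarrow> real ^ 'n" and A :: "nat \<Rightarrow> real ^ 'm ^ 'n"
  assumes V: "open V" and m: "m \<longlonglongrightarrow> m0" and A: "A \<longlonglongrightarrow> A0"
    and limit: "AE g in std_gaussian. m0 + A0 *v g \<in> V"
  shows "(\<lambda>j. measure std_gaussian {g. m j + A j *v g \<in> V}) \<longlonglongrightarrow> 1"
proof -
  interpret prob_space "std_gaussian :: (real ^ 'm) measure" by (rule prob_space_std_gaussian)
  have sets: "{g. m j + A j *v g \<in> V} \<in> sets borel" for j
  proof -
    have "continuous_on UNIV (\<lambda>g. m j + A j *v g)" by (intro continuous_intros)
    from open_vimage[OF V this] show ?thesis by (simp add: vimage_def borel_open)
  qed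
  have ind: "(\<lambda>g. indicator {g. m j + A j *v g \<in> V} g :: real) \<in> borel_measurable std_gaussian" for j
    using sets[of j] by (intro borel_measurable_indicator) simp
  have "(\<lambda>j. \<integral>g. indicator {g. m j + A j *v g \<in> V} g \<partial>std_gaussian) \<longlonglongrightarrow> (\<integral>g. (1 :: real) \<partial>(std_gaussian :: (real ^ 'm) measure))"
  proof (rule integral_dominated_convergence[where w = "\<lambda>_. 1"])
    show "AE g in std_gaussian. (\<lambda>j. indicator {g. m j + A j *v g \<in> V} g) \<longlonglongrightarrow> (1 :: real)"
      using limit
    proof eventually_elim
      case (elim g)
      have "(\<lambda>j. A j *v g) \<longlonglongrightarrow> A0 *v g"
        unfolding matrix_vector_mult_def
        by (intro tendsto_vec_lambda tendsto_sum tendsto_mult tendsto_const tendsto_vec_nth A)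
      then have "(\<lambda>j. m j + A j *v g) \<longlonglongrightarrow> m0 + A0 *v g" by (intro tendsto_add m)
      from topological_tendstoD[OF this V elim] show ?case
        by (intro tendsto_eventually) (auto elim: eventually_mono)
    qed
  qed (use ind in \<open>auto simp: indicator_def\<close>)
  moreover have "(\<integral>g. indicator {g. m j + A j *v g \<in> V} g \<partial>std_gaussian) = measure std_gaussian {g. m j + A j *v g \<in> V}" for j
    using sets by simp
  ultimately show ?thesis using prob_space by simp
qed


section \<open>Gaussian AR(1) vectors near the unit root\<close>

text \<open>
  The coefficients in \<open>y\<^sub>1 = g\<^sub>1\<close>, \<open>y\<^sub>t = \<rho> y\<^sub>t\<^sub>-\<^sub>1 + sqrt (1 - \<rho>\<^sup>2) g\<^sub>t\<close>, the recursion of a stationary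
  AR(1) process with unit variance, solved for \<open>y\<close>. At \<open>\<rho> = \<plusminus>1\<close> only the first column survives.
\<close>
definition AR1_factor :: "real \<Rightarrow> real ^ 'n::{finite,linorder} ^ 'n::{finite,linorder}"
  where "AR1_factor \<rho> = (\<chi> i j. if pos j = 1 then \<rho> ^ (pos i - 1)
    else if pos j \<le> pos i then sqrt (1 - \<rho>\<^sup>2) * \<rho> ^ (pos i - pos j) else 0)"

lemma pos_ge_1: "pos i \<ge> 1" and pos_le_card: "pos (i :: 'n::{finite,linorder}) \<le> CARD('n)"
  using bij_betw_pos[where 'n = 'n] by (auto simp: bij_betw_def)

lemma sum_pos: "(\<Sum>i\<in>(UNIV :: 'n::{finite,linorder} set). f (pos i)) = sum f {1..CARD('n)}"
  using sum.reindex_bij_betw[OF bij_betw_pos[where 'n = 'n], of f] .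

text \<open>
  The covariance of \<open>y\<^sub>a\<close> and \<open>y\<^sub>a\<^sub>+\<^sub>d\<close>. Passing from \<open>a\<close> to \<open>a + 1\<close> multiplies all old terms by
  \<open>\<rho>\<^sup>2\<close> and adds \<open>(1 - \<rho>\<^sup>2) \<rho>\<^sup>d\<close>, which is stationarity.
\<close>
lemma AR1_moving_average_sum:
  fixes \<rho> :: real
  assumes "1 \<le> a"
  shows "(\<Sum>t = 1..a. if t = 1 then \<rho> ^ (a - 1) * \<rho> ^ (a + d - 1)
     else (1 - \<rho>\<^sup>2) * (\<rho> ^ (a - t) * \<rho> ^ (a + d - t))) = \<rho> ^ d"
  using assms
proof (induction a rule: dec_induct)
  case base
  show ?case by simp
next
  case (step a)
  let ?f = "\<lambda>a t. if t = 1 then \<rho> ^ (a - 1) * \<rho> ^ (a + d - 1)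
     else (1 - \<rho>\<^sup>2) * (\<rho> ^ (a - t) * \<rho> ^ (a + d - t))"
  have "?f (Suc a) t = \<rho>\<^sup>2 * ?f a t" if "t \<in> {1..a}" for t
  proof -
    obtain b where "a = Suc b" using step.hyps by (cases a) auto
    moreover have "Suc a - t = Suc (a - t)" "Suc a + d - t = Suc (a + d - t)" using that by auto
    ultimately show ?thesis by (simp add: power2_eq_square)
  qed
  then have "(\<Sum>t = 1..Suc a. ?f (Suc a) t) = \<rho>\<^sup>2 * (\<Sum>t = 1..a. ?f a t) + ?f (Suc a) (Suc a)"
    using step.hyps by (simp add: sum_distrib_left del: One_nat_def)
  also have "\<dots> = \<rho> ^ d" using step by (simp add: algebra_simps)
  finally show ?case .
qed

lemma AR1_mat_eq_factor:
  assumes "-1 < \<rho>" "\<rho> < 1"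
  shows "AR1_mat \<rho> = AR1_factor \<rho> ** transpose (AR1_factor \<rho> :: real ^ 'n::{finite,linorder} ^ 'n::{finite,linorder})"
proof -
  let ?L = "AR1_factor \<rho> :: ((real, 'n) vec, 'n) vec"
  have le1: "\<rho>\<^sup>2 \<le> 1" using assms by (simp add: abs_square_le_1 abs_le_iff)
  have upper: "(?L ** transpose ?L) $ i $ k = \<rho> ^ (pos k - pos i)" if le: "pos i \<le> pos k" for i k :: 'n
  proof -
    define a d where "a = pos i" and "d = pos k - pos i"
    have k: "pos k = a + d" and a: "1 \<le> a" "a \<le> CARD('n)"
      using le pos_ge_1[of i] pos_le_card[of i] by (auto simp: a_def d_def)
    let ?f = "\<lambda>t. if t = 1 then \<rho> ^ (a - 1) * \<rho> ^ (a + d - 1)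
      else if t \<le> a then (1 - \<rho>\<^sup>2) * (\<rho> ^ (a - t) * \<rho> ^ (a + d - t)) else 0"
    have "?L $ i $ j * ?L $ k $ j = ?f (pos j)" for j
      using le1 by (simp add: AR1_factor_def k flip: a_def)
    then have "(?L ** transpose ?L) $ i $ k = (\<Sum>j\<in>(UNIV :: 'n set). ?f (pos j))"
      by (simp only: matrix_matrix_mult_def transpose_def vec_lambda_beta)
    also have "\<dots> = (\<Sum>t = 1..CARD('n). ?f t)" by (rule sum_pos)
    also have "\<dots> = (\<Sum>t = 1..a. ?f t)"
      using a by (intro sum.mono_neutral_right) auto
    also have "\<dots> = (\<Sum>t = 1..a. if t = 1 then \<rho> ^ (a - 1) * \<rho> ^ (a + d - 1)
      else (1 - \<rho>\<^sup>2) * (\<rho> ^ (a - t) * \<rho> ^ (a + d - t)))"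
      by (rule sum.cong) auto
    also have "\<dots> = \<rho> ^ d" by (rule AR1_moving_average_sum[OF a(1)])
    finally show ?thesis by (simp add: d_def)
  qed
  have sym: "(?L ** transpose ?L) $ i $ k = (?L ** transpose ?L) $ k $ i" for i k :: 'n
    by (simp add: matrix_matrix_mult_def transpose_def mult.commute)
  have "AR1_mat \<rho> $ i $ k = (?L ** transpose ?L) $ i $ k" for i k :: 'n
  proof (cases "pos i \<le> pos k")
    case True
    then have "nat \<bar>int (pos i) - int (pos k)\<bar> = pos k - pos i" by auto
    then show ?thesis using upper[OF True] by (simp only: AR1_mat_def vec_lambda_beta)
  next
    case False
    then have "nat \<bar>int (pos i) - int (pos k)\<bar> = pos i - pos k" and "pos k \<le> pos i" by auto
    then show ?thesis using upper[of k i] sym[of i k] by (simp only: AR1_mat_def vec_lambda_beta)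
  qed
  then show ?thesis by (simp add: vec_eq_iff)
qed

lemma tendsto_AR1_factor:
  fixes \<rho> :: "nat \<Rightarrow> real"
  assumes "\<rho> \<longlonglongrightarrow> \<rho>0"
  shows "(\<lambda>j. AR1_factor (\<rho> j) :: real ^ 'n::{finite,linorder} ^ 'n::{finite,linorder}) \<longlonglongrightarrow> AR1_factor \<rho>0"
proof -
  have "(\<lambda>j. if pos k = 1 then \<rho> j ^ (pos i - 1)
    else if pos k \<le> pos i then sqrt (1 - (\<rho> j)\<^sup>2) * \<rho> j ^ (pos i - pos k) else 0) \<longlonglongrightarrow>
    (if pos k = 1 then \<rho>0 ^ (pos i - 1)
    else if pos k \<le> pos i then sqrt (1 - \<rho>0\<^sup>2) * \<rho>0 ^ (pos i - pos k) else 0)" for i k :: 'n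
    using assms by (auto intro!: tendsto_intros)
  then show ?thesis unfolding AR1_factor_def by (intro tendsto_vec_lambda)
qed

lemma AR1_factor_unit_root:
  fixes g :: "real ^ 'n::{finite,linorder}"
  assumes "\<rho>\<^sup>2 = 1"
  shows "AR1_factor \<rho> *v g = g $ at_time 1 *\<^sub>R (\<chi> i :: 'n. \<rho> ^ (pos i - 1))"
proof -
  have p: "pos (at_time 1 :: 'n) = 1"
    using bij_betw_pos[where 'n = 'n] by (auto simp: at_time_def bij_betw_def f_inv_into_f Suc_leI)
  have "pos j = 1 \<longleftrightarrow> j = at_time 1" for j :: 'n
    using p strict_mono_pos[where 'n = 'n] by (metis strict_mono_eq)
  then have "(if pos j = 1 then \<rho> ^ (pos i - 1) else if pos j \<le> pos i then sqrt (1 - \<rho>\<^sup>2) * \<rho> ^ (pos i - pos j) else 0) * g $ j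
     = (if j = at_time 1 then \<rho> ^ (pos i - 1) * g $ j else 0)" for i j :: 'n
    using assms by simp
  then show ?thesis
    by (simp add: AR1_factor_def matrix_vector_mult_def vec_eq_iff mult.commute)
qed

lemma AE_std_gaussian_coordinate_nonzero: "AE g in std_gaussian. (g :: real ^ 'n) $ i \<noteq> 0"
proof -
  have "AE g in lborel. axis i 1 \<bullet> (g :: real ^ 'n) \<noteq> 0"
    by (rule AE_lborel_hyperplane) (simp add: axis_eq_0_iff)
  moreover have "(\<lambda>g. ennreal (\<Prod>b\<in>Basis. std_normal_density ((g :: real ^ 'n) \<bullet> b))) \<in> borel_measurable lborel"
    by measurable
  ultimately show ?thesis
    unfolding std_gaussian_def by (subst AE_density) (auto simp: inner_axis' elim: eventually_mono)
qed

text \<open>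
  With \<open>y = \<mu> + sqrt s L(\<rho>) g\<close>, the cone property turns \<open>y - \<mu>0 \<in> V\<close> into
  \<open>(\<mu> - \<mu>0) / sqrt s + L(\<rho>) g \<in> V\<close>. By assumption the first summand vanishes in the limit and the second
  tends to a multiple of the direction in \<open>V\<close>, a nonzero one unless \<open>g\<^sub>1 = 0\<close>. Allowing
  \<open>\<mu>\<close> and \<open>s\<close> to vary covers both ways in which an alternative looks like the null hypothesis: a mean
  tending to \<open>\<mu>0\<close> and a variance tending to infinity.
\<close>
lemma AR1_gaussian_concentrates:
  fixes V :: "(real ^ 'n::{finite,linorder}) set"
  assumes V: "open V" and cone: "\<And>a z. a \<noteq> 0 \<Longrightarrow> z \<in> V \<Longrightarrow> a *\<^sub>R z \<in> V"
    and e: "(\<chi> i. \<epsilon> ^ (pos i - 1)) \<in> V" and \<epsilon>: "\<epsilon>\<^sup>2 = 1"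
    and \<rho>: "\<And>j. -1 < \<rho> j" "\<And>j. \<rho> j < 1" "\<rho> \<longlonglongrightarrow> \<epsilon>"
    and s: "\<And>j. s j > 0"
    and posdef: "\<And>j. sym_posdef (AR1_mat (\<rho> j) :: real ^ 'n::{finite,linorder} ^ 'n::{finite,linorder})"
    and \<mu>: "(\<lambda>j. (1 / sqrt (s j)) *\<^sub>R (\<mu> j - \<mu>0)) \<longlonglongrightarrow> 0"
  shows "(\<lambda>j. rej_prob {y. y - \<mu>0 \<in> V} (\<mu> j) (s j) (AR1_mat (\<rho> j))) \<longlonglongrightarrow> 1"
proof -
  define L where "L j = (AR1_factor (\<rho> j) :: ((real, 'n) vec, 'n) vec)" for j
  define m where "m j = (1 / sqrt (s j)) *\<^sub>R (\<mu> j - \<mu>0)" for j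
  have cone_iff: "a *\<^sub>R z \<in> V \<longleftrightarrow> z \<in> V" if "a \<noteq> 0" for a z
    using cone[OF that, of z] cone[of "1 / a" "a *\<^sub>R z"] that by auto
  have "AE g in std_gaussian. 0 + AR1_factor \<epsilon> *v g \<in> V"
    using AE_std_gaussian_coordinate_nonzero[of "at_time 1 :: 'n"]
    by eventually_elim (use e in \<open>simp add: AR1_factor_unit_root[OF \<epsilon>] cone_iff\<close>)
  then have "(\<lambda>j. measure std_gaussian {g. m j + L j *v g \<in> V}) \<longlonglongrightarrow> 1"
    unfolding L_def m_def by (rule std_gaussian_affine_tendsto_1[OF V \<mu> tendsto_AR1_factor[OF \<rho>(3)]])
  moreover have "rej_prob {y. y - \<mu>0 \<in> V} (\<mu> j) (s j) (AR1_mat (\<rho> j)) =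
    measure std_gaussian {g. m j + L j *v g \<in> V}" for j
  proof -
    define A where "A = sqrt (s j) *\<^sub>R L j"
    have A: "s j *\<^sub>R AR1_mat (\<rho> j) = A ** transpose A"
      using s[of j] AR1_mat_eq_factor[OF \<rho>(1,2), of j, where 'n = 'n]
      by (simp add: A_def L_def transpose_scalar matrix_scalar_ac flip: scalar_matrix_assoc)
    have "det (s j *\<^sub>R AR1_mat (\<rho> j) :: ((real, 'n) vec, 'n) vec) \<noteq> 0"
      by (rule sym_posdef_det_nonzero[OF sym_posdef_scaleR[OF posdef s]])
    note distr = gaussian_eq_distr[OF A this, of "\<mu> j"]
    have "continuous_on UNIV (\<lambda>y. y - \<mu>0)" by (intro continuous_intros)
    from open_vimage[OF V this] have "{y. y - \<mu>0 \<in> V} \<in> sets borel" by (simp add: vimage_def borel_open)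
    moreover have "(\<lambda>g. \<mu> j + A *v g) \<in> measurable std_gaussian borel" by measurable
    ultimately have "rej_prob {y. y - \<mu>0 \<in> V} (\<mu> j) (s j) (AR1_mat (\<rho> j)) =
      measure std_gaussian ((\<lambda>g. \<mu> j + A *v g) -` {y. y - \<mu>0 \<in> V})"
      by (simp add: rej_prob_def distr measure_distr)
    also have "(\<lambda>g. \<mu> j + A *v g) -` {y. y - \<mu>0 \<in> V} = {g. m j + L j *v g \<in> V}"
    proof -
      have "\<mu> j + A *v g - \<mu>0 = sqrt (s j) *\<^sub>R (m j + L j *v g)" for g
        using s[of j] by (simp add: A_def m_def scaleR_matrix_vector_assoc[symmetric] algebra_simps)
      then show ?thesis using s[of j] by (simp add: vimage_def cone_iff)
    qed
    finally show ?thesis .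
  qed
  ultimately show ?thesis by simp
qed


section \<open>Least squares and the covariance estimator\<close>

context
  fixes X :: "real ^ 'k ^ 'n::{finite,linorder}"
  assumes full_rank: "rank X = CARD('k)"
begin

lemma gram_det_nonzero: "det (transpose X ** X) \<noteq> 0"
  unfolding det_nonzero_iff_injective
proof (intro allI impI)
  fix b assume "(transpose X ** X) *v b = 0"
  then have "(X *v b) \<bullet> (X *v b) = 0"
    by (simp add: inner_matrix_transpose[of "X *v b" X b] matrix_vector_mul_assoc)
  then have "X *v b = X *v 0" by simp
  then show "b = 0" using full_rank by (metis full_rank_injective injD)
qed

lemma transpose_gram_inv: "transpose (matrix_inv (transpose X ** X)) = matrix_inv (transpose X ** X)"
proof -
  have "transpose (transpose X ** X) = transpose X ** X" by (simp add: matrix_transpose_mul)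
  then have "(transpose X ** X) ** transpose (matrix_inv (transpose X ** X)) = mat 1"
    using matrix_inv_cancel(2)[OF gram_det_nonzero] by (metis matrix_transpose_mul transpose_mat)
  then show ?thesis by (metis matrix_inv_unique)
qed

lemma beta_hat_mean_shift: "beta_hat X (X *v b + z) = b + beta_hat X z"
proof -
  have "matrix_inv (transpose X ** X) ** transpose X ** X = mat 1"
    using matrix_inv_cancel(2)[OF gram_det_nonzero] by (simp add: matrix_mul_assoc)
  then show ?thesis
    by (simp add: beta_hat_def matrix_vector_right_distrib matrix_vector_mul_assoc)
qed

lemma u_hat_mean_shift: "u_hat X (X *v b + z) = u_hat X z"
  by (simp add: u_hat_def beta_hat_mean_shift matrix_vector_right_distrib)

lemma beta_hat_u_hat: "beta_hat X (u_hat X z) = 0"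
  using beta_hat_mean_shift[of "beta_hat X z" "u_hat X z"] by (simp add: u_hat_def)

end

lemma beta_hat_scaleR: "beta_hat X (a *\<^sub>R z) = a *\<^sub>R beta_hat X z"
  by (simp add: beta_hat_def matrix_vector_mult_scaleR)

lemma u_hat_scaleR: "u_hat X (a *\<^sub>R z) = a *\<^sub>R u_hat X z"
  by (simp add: u_hat_def beta_hat_scaleR matrix_vector_mult_scaleR scaleR_right_diff_distrib)

text \<open>
  The sum over lags is regrouped as a double sum over time points: lag \<open>j\<close> collects the pairs
  with time difference \<open>j\<close>. This exhibits the weight matrix.
\<close>
lemma Psi_hat_eq:
  fixes X :: "real ^ 'k ^ 'n::{finite,linorder}"
  shows "real CARD('n) *\<^sub>R Psi_hat X w y =
    (\<Sum>i\<in>UNIV. \<Sum>j\<in>UNIV. w (int (pos i) - int (pos j)) *\<^sub>R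
       outer (u_hat X y $ i *\<^sub>R row i X) (u_hat X y $ j *\<^sub>R row j X))"
proof -
  let ?n = "CARD('n)"
  define f where "f a b = outer (v_hat X y a) (v_hat X y b)" for a b
  have at_pos: "at_time (pos i) = i" for i :: 'n
    using strict_mono_pos[where 'n = 'n] by (simp add: at_time_def strict_mono_imp_inj_on)
  have Gamma: "real ?n *\<^sub>R Gamma_hat X y j =
      (\<Sum>(a, b) \<in> {p \<in> {1..?n} \<times> {1..?n}. int (fst p) - int (snd p) = j}. f a b)" for j
  proof (cases "j \<ge> 0")
    case True
    then have "real ?n *\<^sub>R Gamma_hat X y j = (\<Sum>t = nat j + 1..?n. f t (t - nat j))"
      by (simp add: Gamma_hat_def Gamma_hat_nat_def f_def)
    also have "\<dots> = (\<Sum>(a, b) \<in> {p \<in> {1..?n} \<times> {1..?n}. int (fst p) - int (snd p) = j}. f a b)"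
      by (rule sum.reindex_bij_witness[where j = "\<lambda>t. (t, t - nat j)" and i = fst]) (use True in auto)
    finally show ?thesis .
  next
    case False
    have tr: "transpose (\<Sum>t\<in>T. g t) = (\<Sum>t\<in>T. transpose (g t))" for T :: "nat set" and g :: "nat \<Rightarrow> real ^ 'k ^ 'k"
      by (induction T rule: infinite_finite_induct) (auto simp: transpose_def vec_eq_iff)
    have "transpose (outer u v) = outer v u" for u v :: "real ^ 'k"
      by (simp add: transpose_def outer_def mult.commute)
    then have "real ?n *\<^sub>R Gamma_hat X y j = (\<Sum>t = nat (- j) + 1..?n. f (t - nat (- j)) t)"
      using False by (simp add: Gamma_hat_def Gamma_hat_nat_def f_def transpose_scalar tr)
    also have "\<dots> = (\<Sum>(a, b) \<in> {p \<in> {1..?n} \<times> {1..?n}. int (fst p) - int (snd p) = j}. f a b)"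
      by (rule sum.reindex_bij_witness[where j = "\<lambda>t. (t - nat (- j), t)" and i = snd]) (use False in auto)
    finally show ?thesis .
  qed
  have "real ?n *\<^sub>R Psi_hat X w y =
      (\<Sum>j = - (int ?n - 1)..int ?n - 1. w j *\<^sub>R (real ?n *\<^sub>R Gamma_hat X y j))"
    by (simp add: Psi_hat_def scaleR_sum_right mult.commute)
  also have "\<dots> = (\<Sum>j = - (int ?n - 1)..int ?n - 1.
      \<Sum>p \<in> {p \<in> {1..?n} \<times> {1..?n}. int (fst p) - int (snd p) = j}.
        w (int (fst p) - int (snd p)) *\<^sub>R f (fst p) (snd p))"
    unfolding Gamma scaleR_sum_right by (intro sum.cong) auto
  also have "\<dots> = (\<Sum>p \<in> {1..?n} \<times> {1..?n}. w (int (fst p) - int (snd p)) *\<^sub>R f (fst p) (snd p))"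
    by (rule sum.group) auto
  also have "\<dots> = (\<Sum>a = 1..?n. \<Sum>b = 1..?n. w (int a - int b) *\<^sub>R f a b)"
    by (simp add: sum.cartesian_product case_prod_beta)
  also have "\<dots> = (\<Sum>i\<in>(UNIV :: 'n set). \<Sum>j\<in>(UNIV :: 'n set).
      w (int (pos i) - int (pos j)) *\<^sub>R f (pos i) (pos j))"
    unfolding sum.reindex_bij_betw[OF bij_betw_pos[where 'n = 'n], symmetric] ..
  finally show ?thesis by (simp add: f_def v_hat_def at_pos)
qed

text \<open>
  The sandwich form, from which all properties of the covariance estimator follow: homogeneity,
  continuity, positive semidefiniteness and the description of its singularities.
\<close>
lemma Omega_hat_eq:
  fixes X :: "real ^ 'k ^ 'n::{finite,linorder}"
  assumes "rank X = CARD('k)"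
  shows "Omega_hat X R w y = B_mat X R y ** toeplitz w ** transpose (B_mat X R y)"
proof -
  let ?G = "matrix_inv (transpose X ** X)" and ?D = "diag_mat (u_hat X y)"
  have "real CARD('n) *\<^sub>R Psi_hat X w y = (transpose X ** ?D) ** toeplitz w ** transpose (transpose X ** ?D)"
  proof -
    have XD: "(transpose X ** ?D) $ a $ i = u_hat X y $ i * X $ i $ a" for a i
      by (simp add: matrix_matrix_mult_def transpose_def diag_mat_def if_distrib mult.commute cong: if_cong)
    have "(real CARD('n) *\<^sub>R Psi_hat X w y) $ a $ b =
       ((transpose X ** ?D) ** toeplitz w ** transpose (transpose X ** ?D)) $ a $ b" for a b
    proof -
      have "(real CARD('n) *\<^sub>R Psi_hat X w y) $ a $ b =
        (\<Sum>i\<in>UNIV. \<Sum>j\<in>UNIV. w (int (pos i) - int (pos j)) * ((u_hat X y $ i * X $ i $ a) * (u_hat X y $ j * X $ j $ b)))"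
        unfolding Psi_hat_eq by (simp add: outer_def row_def)
      also have "\<dots> = (\<Sum>j\<in>UNIV. \<Sum>i\<in>UNIV. w (int (pos i) - int (pos j)) * ((u_hat X y $ i * X $ i $ a) * (u_hat X y $ j * X $ j $ b)))"
        by (rule sum.swap)
      also have "\<dots> = (\<Sum>j\<in>UNIV. (\<Sum>i\<in>UNIV. (transpose X ** ?D) $ a $ i * toeplitz w $ i $ j) * (transpose X ** ?D) $ b $ j)"
        by (simp add: XD toeplitz_def sum_distrib_left sum_distrib_right mult_ac)
      also have "\<dots> = ((transpose X ** ?D) ** toeplitz w ** transpose (transpose X ** ?D)) $ a $ b"
        by (simp only: matrix_matrix_mult_def transpose_def vec_lambda_beta)
      finally show ?thesis .
    qed
    then show ?thesis by (simp add: vec_eq_iff)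
  qed
  moreover have "Omega_hat X R w y = R ** ?G ** (real CARD('n) *\<^sub>R Psi_hat X w y) ** ?G ** transpose R"
    unfolding Omega_hat_def by (simp add: matrix_scalar_ac scalar_matrix_assoc[symmetric])
  ultimately show ?thesis
    using transpose_gram_inv[OF assms]
    by (simp add: B_mat_def matrix_transpose_mul matrix_mul_assoc)
qed


section \<open>The test statistic\<close>

lemma Omega_hat_mean_shift:
  assumes "rank X = CARD('k)"
  shows "Omega_hat (X :: real ^ 'k ^ 'n::{finite,linorder}) R w (X *v b + z) = Omega_hat X R w z"
proof -
  have "v_hat X (X *v b + z) t = v_hat X z t" for t
    by (simp add: v_hat_def u_hat_mean_shift[OF assms])
  then have "Gamma_hat_nat X (X *v b + z) = Gamma_hat_nat X z"
    by (simp add: Gamma_hat_nat_def fun_eq_iff)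
  then have "Gamma_hat X (X *v b + z) = Gamma_hat X z"
    by (auto simp: Gamma_hat_def fun_eq_iff)
  then show ?thesis by (simp add: Omega_hat_def Psi_hat_def)
qed

lemma T_stat_mean_shift:
  assumes "rank X = CARD('k)" and \<mu>: "\<mu> \<in> hyp_null (X :: real ^ 'k ^ 'n::{finite,linorder}) R r"
  shows "T_stat X R r w (\<mu> + z) = T_stat X R 0 w z"
proof -
  obtain b where b: "\<mu> = X *v b" "R *v b = r" using \<mu> by (auto simp: hyp_null_def)
  then have "R *v beta_hat X (\<mu> + z) - r = R *v beta_hat X z - 0"
    by (simp add: beta_hat_mean_shift[OF assms(1)] matrix_vector_right_distrib)
  then show ?thesis by (simp add: T_stat_def b(1) Omega_hat_mean_shift[OF assms(1)])
qed

lemma B_mat_scaleR: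
  fixes X :: "real ^ 'k ^ 'n"
  shows "B_mat X R (a *\<^sub>R z) = a *\<^sub>R B_mat X R z"
proof -
  have "diag_mat (a *\<^sub>R u) = a *\<^sub>R diag_mat u" for u :: "real ^ 'n"
    by (simp add: diag_mat_def vec_eq_iff)
  then show ?thesis by (simp add: B_mat_def u_hat_scaleR matrix_scalar_ac flip: scalar_matrix_assoc)
qed

lemma Omega_hat_scaleR:
  assumes "rank X = CARD('k)"
  shows "Omega_hat (X :: real ^ 'k ^ 'n::{finite,linorder}) R w (a *\<^sub>R z) = a\<^sup>2 *\<^sub>R Omega_hat X R w z"
  by (simp add: Omega_hat_eq[OF assms] B_mat_scaleR transpose_scalar matrix_scalar_ac power2_eq_square
      flip: scalar_matrix_assoc)

lemma det_scaleR_nonzero: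
  fixes A :: "real ^ 'm ^ 'm"
  assumes "c \<noteq> 0"
  shows "det (c *\<^sub>R A) = 0 \<longleftrightarrow> det A = 0"
proof -
  have "det (c *\<^sub>R A) \<noteq> 0 \<longleftrightarrow> det A \<noteq> 0"
    unfolding det_nonzero_iff_injective using assms by (simp add: scaleR_matrix_vector_assoc[symmetric])
  then show ?thesis by blast
qed

text \<open>
  Numerator and denominator are both of degree two. With \<open>r = 0\<close> this is scale invariance about the
  null hypothesis.
\<close>
lemma T_stat_scaleR:
  assumes "rank X = CARD('k)" "a \<noteq> 0"
  shows "T_stat (X :: real ^ 'k ^ 'n::{finite,linorder}) R 0 w (a *\<^sub>R z) = T_stat X R 0 w z"
proof (cases "det (Omega_hat X R w z) = 0")
  case True
  then show ?thesis
    using assms(2) by (simp add: T_stat_def Omega_hat_scaleR[OF assms(1)] det_scaleR_nonzero)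
next
  case False
  let ?b = "R *v beta_hat X z" and ?x = "matrix_inv (Omega_hat X R w z) *v (R *v beta_hat X z)"
  have det: "det (a\<^sup>2 *\<^sub>R Omega_hat X R w z) \<noteq> 0" using False assms(2) by (simp add: det_scaleR_nonzero)
  have "Omega_hat X R w z *v ?x = ?b" using matrix_inv_solves[OF False] by blast
  then have "matrix_inv (a\<^sup>2 *\<^sub>R Omega_hat X R w z) *v (a *\<^sub>R ?b) = (1 / a) *\<^sub>R ?x"
    unfolding matrix_inv_solves[OF det] using assms(2)
    by (simp add: scaleR_matrix_vector_assoc[symmetric] matrix_vector_mult_scaleR power2_eq_square)
  then show ?thesis
    using False det assms(2)
    by (simp add: T_stat_def Omega_hat_scaleR[OF assms(1)] beta_hat_scaleR matrix_vector_mult_scaleR)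
qed

lemma continuous_on_matrix_mult [continuous_intros]:
  fixes A :: "'a::topological_space \<Rightarrow> real ^ 'm ^ 'n" and B :: "'a \<Rightarrow> real ^ 'p ^ 'm"
  assumes "continuous_on S A" "continuous_on S B"
  shows "continuous_on S (\<lambda>x. A x ** B x)"
  unfolding matrix_matrix_mult_def using assms by (intro continuous_intros)

lemma continuous_on_transpose [continuous_intros]:
  fixes A :: "'a::topological_space \<Rightarrow> real ^ 'm ^ 'n"
  assumes "continuous_on S A"
  shows "continuous_on S (\<lambda>x. transpose (A x))"
  unfolding transpose_def using assms by (intro continuous_intros)

lemma continuous_on_det [continuous_intros]:
  fixes A :: "'a::topological_space \<Rightarrow> real ^ 'm ^ 'm"
  assumes "continuous_on S A"
  shows "continuous_on S (\<lambda>x. det (A x))"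
  unfolding det_def using assms by (intro continuous_intros)

text \<open>
  By Cramer's rule the solution of a linear system is a quotient of determinants.
\<close>
lemma continuous_on_matrix_inv_mult:
  fixes A :: "'a::topological_space \<Rightarrow> real ^ 'm ^ 'm"
  assumes "continuous_on S A" "continuous_on S b" and nz: "\<And>x. x \<in> S \<Longrightarrow> det (A x) \<noteq> 0"
  shows "continuous_on S (\<lambda>x. matrix_inv (A x) *v b x)"
proof -
  have cof: "continuous_on S (\<lambda>x. \<chi> i j. if j = k then b x $ i else A x $ i $ j)" for k
  proof -
    have "continuous_on S (\<lambda>x. if j = k then b x $ i else A x $ i $ j)" for i j
      using assms(1,2) by (cases "j = k") (auto intro!: continuous_intros)
    then show ?thesis by (intro continuous_intros)
  qed
  have "continuous_on S (\<lambda>x. \<chi> k. det (\<chi> i j. if j = k then b x $ i else A x $ i $ j) / det (A x))"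
    by (rule continuous_on_vec_lambda, rule continuous_on_divide)
      (use nz in \<open>auto intro: continuous_on_det cof assms(1)\<close>)
  moreover have "matrix_inv (A x) *v b x = (\<chi> k. det (\<chi> i j. if j = k then b x $ i else A x $ i $ j) / det (A x))"
    if "x \<in> S" for x
    using nz[OF that] by (simp add: matrix_inv_solves cramer)
  ultimately show ?thesis by (simp cong: continuous_on_cong)
qed

lemma continuous_on_beta_hat: "continuous_on S (beta_hat X)"
  unfolding beta_hat_def[abs_def] by (intro continuous_intros)

lemma continuous_on_B_mat: "continuous_on S (B_mat X R)"
proof -
  have u: "continuous_on S (u_hat X)"
    unfolding u_hat_def[abs_def] by (intro continuous_intros continuous_on_beta_hat)
  have "continuous_on S (\<lambda>y. if i = j then u_hat X y $ i else 0)" for i j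
    using u by (cases "i = j") (auto intro!: continuous_intros)
  then have "continuous_on S (\<lambda>y. diag_mat (u_hat X y))"
    unfolding diag_mat_def by (intro continuous_intros)
  then show ?thesis unfolding B_mat_def[abs_def] by (intro continuous_intros)
qed

lemma continuous_on_Omega_hat:
  assumes "rank X = CARD('k)"
  shows "continuous_on S (Omega_hat (X :: real ^ 'k ^ 'n::{finite,linorder}) R w)"
  unfolding Omega_hat_eq[OF assms, abs_def]
  by (intro continuous_intros continuous_on_B_mat)

lemma open_Omega_hat_nonsingular:
  assumes "rank X = CARD('k)"
  shows "open {y. det (Omega_hat (X :: real ^ 'k ^ 'n::{finite,linorder}) R w y) \<noteq> 0}"
  by (intro open_Collect_neq continuous_intros continuous_on_Omega_hat[OF assms])

lemma continuous_on_T_stat: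
  assumes "rank X = CARD('k)"
  shows "continuous_on {y. det (Omega_hat X R w y) \<noteq> 0} (T_stat (X :: real ^ 'k ^ 'n::{finite,linorder}) R r w)"
proof -
  let ?b = "\<lambda>y. R *v beta_hat X y - r" and ?D = "{y. det (Omega_hat X R w y) \<noteq> 0}"
  have "continuous_on ?D (\<lambda>y. ?b y \<bullet> (matrix_inv (Omega_hat X R w y) *v ?b y))"
    by (intro continuous_intros continuous_on_matrix_inv_mult continuous_on_Omega_hat[OF assms]
        continuous_on_beta_hat) auto
  then show ?thesis by (rule continuous_on_eq) (simp add: T_stat_def)
qed

lemma open_T_stat_preimage:
  assumes "rank X = CARD('k)" "open A"
  shows "open {y. det (Omega_hat (X :: real ^ 'k ^ 'n::{finite,linorder}) R w y) \<noteq> 0 \<and> T_stat X R r w y \<in> A}"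
  using continuous_open_preimage[OF continuous_on_T_stat[OF assms(1)] open_Omega_hat_nonsingular[OF assms(1)] assms(2)]
  by (simp add: vimage_def Int_def)

lemma rejection_region_borel:
  assumes "rank X = CARD('k)"
  shows "rejection_region (X :: real ^ 'k ^ 'n::{finite,linorder}) R r w C \<in> sets borel"
proof -
  let ?D = "{y. det (Omega_hat X R w y) \<noteq> 0}"
  have "(\<lambda>y. if y \<in> ?D then T_stat X R r w y else 0) \<in> borel_measurable borel"
    by (intro borel_measurable_continuous_on_if borel_open open_Omega_hat_nonsingular[OF assms]
        continuous_on_T_stat[OF assms] continuous_on_const)
  also have "(\<lambda>y. if y \<in> ?D then T_stat X R r w y else 0) = T_stat X R r w"
    by (auto simp: T_stat_def)
  finally have T [measurable]: "T_stat X R r w \<in> borel_measurable borel" .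
  have "{y \<in> space borel. C \<le> T_stat X R r w y} \<in> sets borel" by measurable
  then show ?thesis by (simp add: rejection_region_def)
qed

context
  fixes X :: "real ^ 'k ^ 'n::{finite,linorder}" and R :: "real ^ 'k ^ 'q" and w :: "int \<Rightarrow> real"
  assumes full_rank: "rank X = CARD('k)" and admissible: "admissible TYPE('n) w"
begin

lemma Omega_hat_quadratic_form:
  "x \<bullet> (Omega_hat X R w y *v x) =
    (transpose (B_mat X R y) *v x) \<bullet> (toeplitz w *v (transpose (B_mat X R y) *v x))"
  by (simp add: Omega_hat_eq[OF full_rank] matrix_vector_mul_assoc[symmetric]
      inner_matrix_transpose[of x "B_mat X R y"])

lemma toeplitz_posdef: "sym_posdef (toeplitz w :: ((real, 'n) vec, 'n) vec)"
  using admissible by (simp add: admissible_def)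

lemma Omega_hat_psd: "x \<bullet> (Omega_hat X R w y *v x) \<ge> 0"
  using toeplitz_posdef unfolding Omega_hat_quadratic_form sym_posdef_def
  by (cases "transpose (B_mat X R y) *v x = 0") (auto simp: less_imp_le)

text \<open>
  \<open>x' \<Omega> x\<close> is the positive definite form of the weights at \<open>B' x\<close>, so \<open>\<Omega>\<close> and \<open>B'\<close> have the same
  kernel.
\<close>
lemma Omega_hat_nonsingular_iff:
  "det (Omega_hat X R w y) \<noteq> 0 \<longleftrightarrow> rank (B_mat X R y) = CARD('q)"
proof -
  have "Omega_hat X R w y *v x = 0 \<longleftrightarrow> transpose (B_mat X R y) *v x = 0" for x
  proof
    assume "Omega_hat X R w y *v x = 0"
    then have "(transpose (B_mat X R y) *v x) \<bullet> (toeplitz w *v (transpose (B_mat X R y) *v x)) = 0"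
      unfolding Omega_hat_quadratic_form[symmetric] by simp
    then show "transpose (B_mat X R y) *v x = 0"
      using toeplitz_posdef unfolding sym_posdef_def by (metis less_irrefl)
  qed (simp add: Omega_hat_eq[OF full_rank] matrix_vector_mul_assoc[symmetric])
  then have "det (Omega_hat X R w y) \<noteq> 0 \<longleftrightarrow> rank (transpose (B_mat X R y)) = CARD('q)"
    unfolding det_nonzero_iff_injective using matrix_nonfull_linear_equations_eq by metis
  then show ?thesis by (simp only: rank_transpose)
qed

lemma Omega_hat_sym: "x \<bullet> (Omega_hat X R w y *v z) = z \<bullet> (Omega_hat X R w y *v x)"
proof -
  have "transpose (Omega_hat X R w y) = Omega_hat X R w y"
    using toeplitz_posdef
    by (simp add: Omega_hat_eq[OF full_rank] matrix_transpose_mul sym_posdef_def matrix_mul_assoc)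
  then show ?thesis by (metis inner_commute inner_matrix_transpose)
qed

text \<open>
  Cauchy-Schwarz for the form \<open>\<Omega>\<close>, applied to \<open>b\<close> and \<open>x = \<Omega>\<^sup>-\<^sup>1 b\<close>: since \<open>b' \<Omega> x = b' b\<close> and
  \<open>x' \<Omega> x = b' x\<close> is the test statistic, \<open>(b' b)\<^sup>2 \<le> (b' \<Omega> b) T\<close>. A small \<open>\<Omega>\<close> thus forces a large
  statistic.
\<close>
lemma T_stat_gt:
  assumes det: "det (Omega_hat X R w y) \<noteq> 0" and "C > 0"
    and small: "C * (b \<bullet> (Omega_hat X R w y *v b)) < (b \<bullet> b)\<^sup>2" and b: "b = R *v beta_hat X y - r"
  shows "T_stat X R r w y > C"
proof -
  define x where "x = matrix_inv (Omega_hat X R w y) *v b"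
  define q where "q = b \<bullet> (Omega_hat X R w y *v b)"
  have x: "Omega_hat X R w y *v x = b" using matrix_inv_solves[OF det, of b x] by (simp add: x_def)
  have T: "T_stat X R r w y = b \<bullet> x" using det by (simp add: T_stat_def b x_def)
  have "b \<noteq> 0" using small by auto
  then have bb: "b \<bullet> b > 0" by simp
  \<comment> \<open>the minimizer \<open>(b' b) / T\<close> of the quadratic below, with the claimed bound \<open>C\<close> in place of \<open>T\<close>\<close>
  define t where "t = (b \<bullet> b) / C"
  have "0 \<le> (b - t *\<^sub>R x) \<bullet> (Omega_hat X R w y *v (b - t *\<^sub>R x))" by (rule Omega_hat_psd)
  also have "(b - t *\<^sub>R x) \<bullet> (Omega_hat X R w y *v (b - t *\<^sub>R x)) = q - 2 * t * (b \<bullet> b) + t\<^sup>2 * (b \<bullet> x)"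
    using Omega_hat_sym[of b y x]
    by (simp add: matrix_vector_mult_diff_distrib matrix_vector_mult_scaleR x inner_diff_left inner_diff_right
        q_def inner_commute power2_eq_square algebra_simps)
  finally have *: "0 \<le> q - 2 * t * (b \<bullet> b) + t\<^sup>2 * (b \<bullet> x)" .
  have "C * q < C * (t * (b \<bullet> b))" using small \<open>C > 0\<close> by (simp add: q_def t_def power2_eq_square)
  then have "q < t * (b \<bullet> b)" using \<open>C > 0\<close> by simp
  with * have "t * (b \<bullet> b) < t\<^sup>2 * (b \<bullet> x)" by simp
  moreover have "t > 0" using bb \<open>C > 0\<close> by (simp add: t_def)
  ultimately have "b \<bullet> b < t * (b \<bullet> x)" by (simp add: power2_eq_square)
  then show ?thesis using bb \<open>C > 0\<close> by (simp add: T t_def field_simps)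
qed

text \<open>
  The \<open>i\<close>-th column of \<open>B(y)\<close> is \<open>u\<^sub>i(y)\<close> times the \<open>i\<close>-th column of \<open>R (X'X)\<^sup>-\<^sup>1 X'\<close>, where \<open>u\<^sub>i(y)\<close>
  is the inner product of \<open>y\<close> with the residual of the \<open>i\<close>-th basis vector. That residual is nonzero
  exactly if the basis vector is outside the span of \<open>X\<close>. Off finitely many hyperplanes, the
  columns of \<open>B(y)\<close> therefore span all the columns that the rank condition keeps.
\<close>
lemma AE_Omega_hat_nonsingular:
  assumes "rank_condition X R"
  shows "AE y in lborel. det (Omega_hat X R w y) \<noteq> 0"
proof -
  let ?G = "matrix_inv (transpose X ** X)"
  define I where "I = {i. axis i 1 \<notin> span (columns X)}"
  have u_coord: "u_hat X y $ i = u_hat X (axis i 1) \<bullet> y" for i y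
  proof -
    have P: "transpose (X ** ?G ** transpose X) = X ** ?G ** transpose X"
      by (simp add: matrix_transpose_mul transpose_gram_inv[OF full_rank] matrix_mul_assoc)
    have u: "u_hat X z = z - (X ** ?G ** transpose X) *v z" for z
      by (simp add: u_hat_def beta_hat_def matrix_vector_mul_assoc matrix_mul_assoc)
    have "u_hat X y $ i = axis i 1 \<bullet> u_hat X y" by (simp add: inner_axis')
    also have "\<dots> = u_hat X (axis i 1) \<bullet> y"
      unfolding u by (simp add: inner_diff_left inner_diff_right inner_matrix_transpose[of "axis i 1"] P)
    finally show ?thesis .
  qed
  have "u_hat X (axis i 1) \<noteq> 0" if "i \<in> I" for i
  proof
    assume "u_hat X (axis i 1) = 0"
    then have "axis i 1 = X *v beta_hat X (axis i 1)" by (simp add: u_hat_def)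
    then have "axis i 1 \<in> span (columns X)"
      by (metis matrix_vector_mult_in_columnspace)
    then show False using that by (simp add: I_def)
  qed
  then have "AE y in lborel. u_hat X y $ i \<noteq> 0" if "i \<in> I" for i
    unfolding u_coord using AE_lborel_hyperplane that by blast
  then have "AE y in lborel. \<forall>i\<in>I. u_hat X y $ i \<noteq> 0"
    by (subst AE_ball_countable) (auto simp: countable_finite)
  then show ?thesis
  proof eventually_elim
    case (elim y)
    let ?c = "\<lambda>i. (R ** ?G) *v column i (transpose X)"
    have col: "column i (B_mat X R y) = u_hat X y $ i *\<^sub>R ?c i" for i
      by (simp add: B_mat_def column_def matrix_matrix_mult_def matrix_vector_mult_def diag_mat_def vec_eq_iff
          if_distrib mult.commute cong: if_cong)
    have "?c i \<in> span (columns (B_mat X R y))" if "i \<in> I" for i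
    proof -
      have "?c i = (1 / u_hat X y $ i) *\<^sub>R column i (B_mat X R y)" using elim that by (simp add: col)
      moreover have "column i (B_mat X R y) \<in> columns (B_mat X R y)" by (auto simp: columns_def)
      ultimately show ?thesis by (simp add: span_base span_scale)
    qed
    then have "{?c i | i. axis i 1 \<notin> span (columns X)} \<subseteq> span (columns (B_mat X R y))"
      by (auto simp: I_def)
    from dim_subset[OF this] have "CARD('q) \<le> dim (columns (B_mat X R y))"
      using assms by (simp add: rank_condition_def dim_span)
    then have "CARD('q) \<le> rank (B_mat X R y)" by (simp add: column_rank_def)
    with rank_bound[of "B_mat X R y"] show ?case by (simp add: Omega_hat_nonsingular_iff)
  qed
qed

text \<open>
  Let \<open>z = X b + a u\<close> with \<open>u\<close> the residual of \<open>e\<close> and \<open>R b \<noteq> 0\<close>. The estimate \<open>R \<beta>(z) = R b\<close> does not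
  depend on \<open>a\<close>, while \<open>\<Omega>(z) = a\<^sup>2 \<Omega>(e)\<close> is nonsingular and tends to zero with \<open>a\<close>.
\<close>
lemma T_stat_unbounded:
  assumes "rank R = CARD('q)" and e: "rank (B_mat X R e) = CARD('q)" and "C > 0"
  shows "\<exists>z. det (Omega_hat X R w z) \<noteq> 0 \<and> T_stat X R 0 w z > C"
proof -
  obtain c :: "real ^ 'q" where "c \<noteq> 0" by (metis zero_neq_one)
  obtain b where b: "R *v b = c" using assms(1) by (metis full_rank_surjective surjD)
  define u where "u = u_hat X e"
  have "e = X *v beta_hat X e + u" by (simp add: u_def u_hat_def)
  then have "Omega_hat X R w u = Omega_hat X R w e" by (metis Omega_hat_mean_shift[OF full_rank])
  then have Om: "Omega_hat X R w (X *v b + a *\<^sub>R u) = a\<^sup>2 *\<^sub>R Omega_hat X R w e" for a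
    by (simp only: Omega_hat_mean_shift[OF full_rank] Omega_hat_scaleR[OF full_rank])
  define q where "q = c \<bullet> (Omega_hat X R w e *v c)"
  have "((\<lambda>a. C * (a\<^sup>2 * q)) \<longlongrightarrow> C * (0\<^sup>2 * q)) (at 0)" by (intro tendsto_intros)
  then have "\<forall>\<^sub>F a in at 0. C * (a\<^sup>2 * q) < (c \<bullet> c)\<^sup>2"
    by (rule order_tendstoD) (use \<open>c \<noteq> 0\<close> in simp)
  moreover have "\<forall>\<^sub>F a in at (0 :: real). a \<noteq> 0" by (simp add: eventually_at_filter)
  ultimately obtain a where a: "C * (a\<^sup>2 * q) < (c \<bullet> c)\<^sup>2" "a \<noteq> (0 :: real)"
    using eventually_happens'[OF trivial_limit_at, OF eventually_conj] by blast
  let ?z = "X *v b + a *\<^sub>R u"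
  have det: "det (Omega_hat X R w ?z) \<noteq> 0"
    unfolding Om using e a(2) by (simp add: det_scaleR_nonzero Omega_hat_nonsingular_iff)
  have c: "c = R *v beta_hat X ?z - 0"
    by (simp add: beta_hat_mean_shift[OF full_rank] beta_hat_scaleR u_def beta_hat_u_hat[OF full_rank] b)
  have "T_stat X R 0 w ?z > C"
    by (rule T_stat_gt[OF det \<open>C > 0\<close> _ c])
      (use a(1) in \<open>simp add: Om q_def scaleR_matrix_vector_assoc[symmetric]\<close>)
  with det show ?thesis by blast
qed

end


section \<open>Size and power from concentration on a cone\<close>

lemma cINF_eq_0I:
  fixes f :: "'a \<Rightarrow> real"
  assumes nonneg: "\<And>i. i \<in> I \<Longrightarrow> 0 \<le> f i" and small: "\<And>d. d > 0 \<Longrightarrow> \<exists>i\<in>I. f i < d"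
  shows "(INF i\<in>I. f i) = 0"
proof (rule antisym)
  have bdd: "bdd_below (f ` I)" using nonneg by (auto intro!: bdd_belowI2)
  have "I \<noteq> {}" using small[of 1] by auto
  then show "0 \<le> (INF i\<in>I. f i)" using nonneg by (intro cINF_greatest)
  show "(INF i\<in>I. f i) \<le> 0"
  proof (rule field_le_epsilon)
    fix d :: real assume "d > 0"
    then obtain i where "i \<in> I" "f i < d" using small by blast
    then show "(INF i\<in>I. f i) \<le> 0 + d" using cINF_lower[OF bdd] by fastforce
  qed
qed

lemma cSUP_eq_1I:
  fixes f :: "'a \<Rightarrow> real"
  assumes le: "\<And>i. i \<in> I \<Longrightarrow> f i \<le> 1" and large: "\<And>d. d > 0 \<Longrightarrow> \<exists>i\<in>I. f i > 1 - d"
  shows "(SUP i\<in>I. f i) = 1"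
proof (rule antisym)
  have bdd: "bdd_above (f ` I)" using le by (auto intro!: bdd_aboveI2)
  have "I \<noteq> {}" using large[of 1] by auto
  then show "(SUP i\<in>I. f i) \<le> 1" using le by (intro cSUP_least)
  show "1 \<le> (SUP i\<in>I. f i)"
  proof (rule field_le_epsilon)
    fix d :: real assume "d > 0"
    then obtain i where "i \<in> I" "f i > 1 - d" using large by blast
    then show "1 \<le> (SUP i\<in>I. f i) + d" using cSUP_upper[OF _ bdd] by fastforce
  qed
qed

lemma rej_prob_nonneg: "0 \<le> rej_prob W \<mu> s \<Sigma>"
  by (simp add: rej_prob_def)

lemma hyp_null_nonempty:
  fixes R :: "real ^ 'k ^ 'q"
  assumes "rank R = CARD('q)"
  shows "hyp_null X R r \<noteq> {}"
proof -
  obtain b where "R *v b = r" using assms by (metis full_rank_surjective surjD)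
  then show ?thesis by (auto simp: hyp_null_def)
qed

text \<open>
  Perturb a parameter of \<open>\<mu>0\<close> in a direction that \<open>R\<close> does not annihilate; injectivity of \<open>X\<close> keeps
  the perturbed means outside the null hypothesis.
\<close>
lemma hyp_null_approached_by_alt:
  fixes X :: "real ^ 'k ^ 'n" and R :: "real ^ 'k ^ 'q"
  assumes "rank X = CARD('k)" "rank R = CARD('q)" "\<mu>0 \<in> hyp_null X R r"
  obtains \<mu> where "\<And>j :: nat. \<mu> j \<in> hyp_alt X R r" "\<mu> \<longlonglongrightarrow> \<mu>0"
proof -
  obtain b where b: "\<mu>0 = X *v b" "R *v b = r" using assms(3) by (auto simp: hyp_null_def)
  obtain c :: "real ^ 'q" where "c \<noteq> 0" by (metis zero_neq_one)
  obtain d where d: "R *v d = c" using assms(2) by (metis full_rank_surjective surjD)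
  define \<mu> where "\<mu> j = X *v (b + (1 / real (Suc j)) *\<^sub>R d)" for j
  have inj: "inj ((*v) X)" using assms(1) by (simp add: full_rank_injective)
  show thesis
  proof (rule that)
    fix j
    have "R *v (b + (1 / real (Suc j)) *\<^sub>R d) \<noteq> r"
      using \<open>c \<noteq> 0\<close> by (simp add: matrix_vector_right_distrib matrix_vector_mult_scaleR b d del: of_nat_Suc)
    then have "\<mu> j \<notin> hyp_null X R r"
      using injD[OF inj] unfolding hyp_null_def \<mu>_def by blast
    moreover have "\<mu> j \<in> hyp_all X" unfolding hyp_all_def \<mu>_def by (rule matrix_vector_mult_in_columnspace)
    ultimately show "\<mu> j \<in> hyp_alt X R r" by (simp add: hyp_alt_def)
  next
    have "(\<lambda>j. X *v b + (1 / real (Suc j)) *\<^sub>R (X *v d)) \<longlonglongrightarrow> X *v b + 0 *\<^sub>R (X *v d)"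
      by (intro tendsto_intros LIMSEQ_Suc[OF lim_1_over_n])
    then show "\<mu> \<longlonglongrightarrow> \<mu>0"
      by (simp add: \<mu>_def[abs_def] b(1) matrix_vector_right_distrib matrix_vector_mult_scaleR del: of_nat_Suc)
  qed
qed

context
  fixes X :: "real ^ 'k ^ 'n::{finite,linorder}" and R :: "real ^ 'k ^ 'q" and r :: "real ^ 'q"
    and \<CC> :: "(real ^ 'n::{finite,linorder} ^ 'n::{finite,linorder}) set" and W :: "(real ^ 'n::{finite,linorder}) set"
  assumes full_rank: "rank X = CARD('k)" "rank R = CARD('q)"
    and model: "covariance_model \<CC>" "AR1_model \<subseteq> \<CC>"
    and W: "W \<in> sets borel"
begin

lemma model_posdef: "\<Sigma> \<in> \<CC> \<Longrightarrow> sym_posdef \<Sigma>"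
  using model(1) by (simp add: covariance_model_def)

lemma prob_space_model: "\<Sigma> \<in> \<CC> \<Longrightarrow> s > 0 \<Longrightarrow> prob_space (gaussian \<mu> (s *\<^sub>R \<Sigma>))"
  by (intro prob_space_gaussian sym_posdef_scaleR model_posdef)

lemma rej_prob_le_1: "\<Sigma> \<in> \<CC> \<Longrightarrow> s > 0 \<Longrightarrow> rej_prob W \<mu> s \<Sigma> \<le> 1"
  unfolding rej_prob_def by (rule prob_space.prob_le_1[OF prob_space_model])

text \<open>
  The first-component normalization of the unit-root direction is \<open>e_plus\<close> at \<open>1\<close> and \<open>- e_minus\<close> at
  \<open>-1\<close>, since \<open>e_minus\<close> starts with \<open>-1\<close>; a cone closed under multiplication by \<open>-1\<close> contains both
  signs.
\<close>
lemma model_concentrates: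
  fixes V :: "(real ^ 'n::{finite,linorder}) set"
  assumes V: "open V" and cone: "\<And>a z. a \<noteq> 0 \<Longrightarrow> z \<in> V \<Longrightarrow> a *\<^sub>R z \<in> V"
    and e: "e_plus \<in> V \<or> e_minus \<in> V"
    and s: "\<And>j. s j > 0" and \<mu>: "(\<lambda>j. (1 / sqrt (s j)) *\<^sub>R (\<mu> j - \<mu>0)) \<longlonglongrightarrow> 0"
  obtains \<Sigma> where "\<And>j. \<Sigma> j \<in> \<CC>" "(\<lambda>j. rej_prob {y. y - \<mu>0 \<in> V} (\<mu> j) (s j) (\<Sigma> j)) \<longlonglongrightarrow> 1"
proof -
  have minus_eq: "(\<chi> i :: 'n. (-1) ^ (pos i - 1)) = (-1) *\<^sub>R (e_minus :: (real, 'n) vec)"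
  proof -
    have "(-1) ^ pos i = (-1 :: real) * (-1) ^ (pos i - 1)" for i :: 'n
      using pos_ge_1[of i] by (simp flip: power_Suc)
    then show ?thesis by (simp add: e_minus_def vec_eq_iff)
  qed
  have minus: "(\<chi> i :: 'n. (-1) ^ (pos i - 1)) \<in> V" if "e_minus \<in> V"
    unfolding minus_eq by (rule cone[OF _ that]) simp
  have plus: "(\<chi> i :: 'n. 1 ^ (pos i - 1)) \<in> V" if "e_plus \<in> V"
    using that by (simp add: e_plus_def)
  obtain \<epsilon> :: real where \<epsilon>: "\<epsilon> = 1 \<or> \<epsilon> = -1" and eV: "(\<chi> i :: 'n. \<epsilon> ^ (pos i - 1)) \<in> V"
    using e minus plus by blast
  define \<rho> where "\<rho> j = \<epsilon> * (1 - 1 / real (Suc (Suc j)))" for j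
  have \<rho>: "-1 < \<rho> j" "\<rho> j < 1" for j using \<epsilon> by (auto simp: \<rho>_def field_simps)
  have "(\<lambda>j. \<epsilon> * (1 - 1 / real (Suc (Suc j)))) \<longlonglongrightarrow> \<epsilon> * (1 - 0)"
    by (intro tendsto_intros LIMSEQ_Suc[OF LIMSEQ_Suc[OF lim_1_over_n]])
  then have lim: "\<rho> \<longlonglongrightarrow> \<epsilon>" by (simp add: \<rho>_def[abs_def])
  have in_model: "AR1_mat (\<rho> j) \<in> \<CC>" for j using model(2) \<rho> by (auto simp: AR1_model_def)
  have "\<epsilon>\<^sup>2 = 1" using \<epsilon> by auto
  from in_model AR1_gaussian_concentrates[OF V cone eV this \<rho> lim s model_posdef[OF in_model] \<mu>]
  show thesis by (rule that)
qed

text \<open>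
  The inclusion is one up to null sets because the cone used for \<open>B(e) = 0\<close> may contain points
  with singular \<open>\<Omega>\<close>, where the statistic is zero by definition.
\<close>
lemma size_eq_1_if_cone_rejects:
  fixes V :: "(real ^ 'n::{finite,linorder}) set"
  assumes V: "open V" "\<And>a z. a \<noteq> 0 \<Longrightarrow> z \<in> V \<Longrightarrow> a *\<^sub>R z \<in> V" "e_plus \<in> V \<or> e_minus \<in> V"
    and VW: "\<And>\<mu>0. \<mu>0 \<in> hyp_null X R r \<Longrightarrow> AE y in lborel. y - \<mu>0 \<in> V \<longrightarrow> y \<in> W"
  shows "(\<forall>\<mu>\<^sub>0\<in>hyp_null X R r. \<forall>s>0. (SUP \<Sigma>\<in>\<CC>. rej_prob W \<mu>\<^sub>0 s \<Sigma>) = 1) \<and> test_size X R r \<CC> W = 1"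
proof -
  have large: "\<exists>\<Sigma>\<in>\<CC>. rej_prob W \<mu>0 s \<Sigma> > 1 - d" if \<mu>0: "\<mu>0 \<in> hyp_null X R r" and "s > 0" "d > 0" for \<mu>0 s d
  proof -
    obtain \<Sigma> where \<Sigma>: "\<And>j :: nat. \<Sigma> j \<in> \<CC>" "(\<lambda>j. rej_prob {y. y - \<mu>0 \<in> V} \<mu>0 s (\<Sigma> j)) \<longlonglongrightarrow> 1"
      using model_concentrates[OF V, of "\<lambda>_. s" "\<lambda>_. \<mu>0" \<mu>0] \<open>s > 0\<close> by auto
    have "\<forall>\<^sub>F j in sequentially. 1 - d < rej_prob {y. y - \<mu>0 \<in> V} \<mu>0 s (\<Sigma> j)"
      using order_tendstoD(1)[OF \<Sigma>(2), of "1 - d"] \<open>d > 0\<close> by simp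
    then obtain j where "1 - d < rej_prob {y. y - \<mu>0 \<in> V} \<mu>0 s (\<Sigma> j)"
      by (auto dest: eventually_happens)
    also have "\<dots> \<le> rej_prob W \<mu>0 s (\<Sigma> j)"
    proof -
      interpret prob_space "gaussian \<mu>0 (s *\<^sub>R \<Sigma> j)" by (rule prob_space_model[OF \<Sigma>(1) \<open>s > 0\<close>])
      show ?thesis
        unfolding rej_prob_def
        by (rule finite_measure_mono_AE) (use AE_gaussian_if_AE_lborel[OF VW[OF \<mu>0]] W in auto)
    qed
    finally show ?thesis using \<Sigma>(1) by blast
  qed
  have "(SUP \<Sigma>\<in>\<CC>. rej_prob W \<mu>0 s \<Sigma>) = 1" if "\<mu>0 \<in> hyp_null X R r" "s > 0" for \<mu>0 s
    using rej_prob_le_1 large that by (intro cSUP_eq_1I) auto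
  moreover have "test_size X R r \<CC> W = 1"
    unfolding test_size_def
  proof (rule cSUP_eq_1I)
    fix d :: real assume "d > 0"
    obtain \<mu>0 where \<mu>0: "\<mu>0 \<in> hyp_null X R r" using hyp_null_nonempty[OF full_rank(2)] by blast
    from large[OF \<mu>0 zero_less_one \<open>d > 0\<close>] obtain \<Sigma> where "\<Sigma> \<in> \<CC>" "rej_prob W \<mu>0 1 \<Sigma> > 1 - d" by blast
    with \<mu>0 show "\<exists>p\<in>hyp_null X R r \<times> {0<..} \<times> \<CC>. (case p of (\<mu>, s, \<Sigma>) \<Rightarrow> rej_prob W \<mu> s \<Sigma>) > 1 - d"
      by (intro bexI[of _ "(\<mu>0, 1, \<Sigma>)"]) auto
  qed (use rej_prob_le_1 in auto)
  ultimately show ?thesis by blast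
qed

text \<open>
  The means under the alternative tend to a null mean for fixed \<open>s\<close>, or are fixed while \<open>s\<close> tends to
  infinity; in both cases \<open>(\<mu> - \<mu>0) / sqrt s\<close> tends to zero and the concentration lemma
  applies. The open set \<open>U\<close> inside the rejection region gives the test positive size, hence bias.
\<close>
lemma power_eq_0_if_cone_accepts:
  fixes V :: "(real ^ 'n::{finite,linorder}) set"
  assumes V: "open V" "\<And>a z. a \<noteq> 0 \<Longrightarrow> z \<in> V \<Longrightarrow> a *\<^sub>R z \<in> V" "e_plus \<in> V \<or> e_minus \<in> V"
    and VW: "\<And>\<mu>0 y. \<mu>0 \<in> hyp_null X R r \<Longrightarrow> y - \<mu>0 \<in> V \<Longrightarrow> y \<notin> W"
    and U: "open U" "U \<noteq> {}" "U \<subseteq> W"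
  shows "(\<forall>\<mu>\<^sub>0\<in>hyp_null X R r. \<forall>s>0. (INF \<Sigma>\<in>\<CC>. rej_prob W \<mu>\<^sub>0 s \<Sigma>) = 0) \<and>
     (\<forall>s>0. (INF \<mu>\<^sub>1\<in>hyp_alt X R r. INF \<Sigma>\<in>\<CC>. rej_prob W \<mu>\<^sub>1 s \<Sigma>) = 0) \<and>
     biased X R r \<CC> W \<and>
     (\<forall>\<mu>\<^sub>1\<in>hyp_alt X R r. (INF s\<in>{0<..}. INF \<Sigma>\<in>\<CC>. rej_prob W \<mu>\<^sub>1 s \<Sigma>) = 0) \<and>
     infimal_power X R r \<CC> W = 0"
proof -
  have small: "\<exists>j. \<exists>\<Sigma>\<in>\<CC>. rej_prob W (\<mu> j) (s j) \<Sigma> < d"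
    if \<mu>0: "\<mu>0 \<in> hyp_null X R r" and "d > 0" and s: "\<And>j :: nat. s j > 0"
      and \<mu>: "(\<lambda>j. (1 / sqrt (s j)) *\<^sub>R (\<mu> j - \<mu>0)) \<longlonglongrightarrow> 0" for \<mu>0 d s \<mu>
  proof -
    obtain \<Sigma> where \<Sigma>: "\<And>j. \<Sigma> j \<in> \<CC>" "(\<lambda>j. rej_prob {y. y - \<mu>0 \<in> V} (\<mu> j) (s j) (\<Sigma> j)) \<longlonglongrightarrow> 1"
      using model_concentrates[OF V s \<mu>] by blast
    have "\<forall>\<^sub>F j in sequentially. 1 - d < rej_prob {y. y - \<mu>0 \<in> V} (\<mu> j) (s j) (\<Sigma> j)"
      using order_tendstoD(1)[OF \<Sigma>(2), of "1 - d"] \<open>d > 0\<close> by simp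
    then obtain j where j: "1 - d < rej_prob {y. y - \<mu>0 \<in> V} (\<mu> j) (s j) (\<Sigma> j)"
      by (auto dest: eventually_happens)
    interpret prob_space "gaussian (\<mu> j) (s j *\<^sub>R \<Sigma> j)" by (rule prob_space_model[OF \<Sigma>(1) s])
    have "continuous_on UNIV (\<lambda>y. y - \<mu>0)" by (intro continuous_intros)
    from open_vimage[OF V(1) this] have "{y. y - \<mu>0 \<in> V} \<in> sets borel" by (simp add: vimage_def borel_open)
    then have "prob {y. y - \<mu>0 \<in> V} \<le> prob (- W)"
      using VW[OF \<mu>0] W by (intro finite_measure_mono) auto
    also have "\<dots> = 1 - prob W" using prob_compl[of W] W by (simp add: Compl_eq_Diff_UNIV)
    finally have "rej_prob W (\<mu> j) (s j) (\<Sigma> j) < d" using j by (simp add: rej_prob_def)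
    then show ?thesis using \<Sigma>(1) by blast
  qed
  have "\<CC> \<noteq> {}" using model(1) by (simp add: covariance_model_def)
  then have INF_nonneg: "0 \<le> (INF \<Sigma>\<in>\<CC>. rej_prob W \<mu> s \<Sigma>)" for \<mu> s
    by (intro cINF_greatest rej_prob_nonneg)
  have INF_le: "(INF \<Sigma>\<in>\<CC>. rej_prob W \<mu> s \<Sigma>) \<le> rej_prob W \<mu> s \<Sigma>" if "\<Sigma> \<in> \<CC>" for \<mu> s \<Sigma>
    using that by (intro cINF_lower bdd_belowI2[where m = 0] rej_prob_nonneg)
  obtain \<mu>0 where \<mu>0: "\<mu>0 \<in> hyp_null X R r" using hyp_null_nonempty[OF full_rank(2)] by blast
  have null: "(INF \<Sigma>\<in>\<CC>. rej_prob W \<mu>\<^sub>0 s \<Sigma>) = 0" if "\<mu>\<^sub>0 \<in> hyp_null X R r" "s > 0" for \<mu>\<^sub>0 s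
    using small[OF that(1), of _ "\<lambda>_. s" "\<lambda>_. \<mu>\<^sub>0"] that(2)
    by (intro cINF_eq_0I rej_prob_nonneg) auto
  have near_null: "\<exists>\<mu>\<in>hyp_alt X R r. \<exists>\<Sigma>\<in>\<CC>. rej_prob W \<mu> s \<Sigma> < d" if "s > 0" "d > 0" for s d
  proof -
    obtain \<mu> where \<mu>: "\<And>j :: nat. \<mu> j \<in> hyp_alt X R r" "\<mu> \<longlonglongrightarrow> \<mu>0"
      using hyp_null_approached_by_alt[OF full_rank \<mu>0] by blast
    have "(\<lambda>j. (1 / sqrt s) *\<^sub>R (\<mu> j - \<mu>0)) \<longlonglongrightarrow> (1 / sqrt s) *\<^sub>R (\<mu>0 - \<mu>0)"
      by (intro tendsto_intros \<mu>(2))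
    then show ?thesis using small[OF \<mu>0 \<open>d > 0\<close>, of "\<lambda>_. s" \<mu>] \<mu>(1) \<open>s > 0\<close> by auto
  qed
  have alt: "(INF \<mu>\<^sub>1\<in>hyp_alt X R r. INF \<Sigma>\<in>\<CC>. rej_prob W \<mu>\<^sub>1 s \<Sigma>) = 0" if "s > 0" for s
    using near_null[OF that] INF_le by (intro cINF_eq_0I INF_nonneg) (meson le_less_trans)
  have large_var: "(INF s\<in>{0<..}. INF \<Sigma>\<in>\<CC>. rej_prob W \<mu>\<^sub>1 s \<Sigma>) = 0" for \<mu>\<^sub>1
  proof (rule cINF_eq_0I[OF INF_nonneg])
    fix d :: real assume "d > 0"
    \<comment> \<open>the noise outgrows the fixed distance of \<open>\<mu>\<^sub>1\<close> from \<open>\<mu>0\<close>\<close>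
    define s where "s j = (real (Suc j))\<^sup>2" for j
    have "(\<lambda>j. (1 / real (Suc j)) *\<^sub>R (\<mu>\<^sub>1 - \<mu>0)) \<longlonglongrightarrow> 0 *\<^sub>R (\<mu>\<^sub>1 - \<mu>0)"
      by (intro tendsto_intros LIMSEQ_Suc[OF lim_1_over_n])
    moreover have "sqrt (s j) = real (Suc j)" for j by (simp only: s_def real_sqrt_abs abs_of_nat)
    ultimately have "(\<lambda>j. (1 / sqrt (s j)) *\<^sub>R (\<mu>\<^sub>1 - \<mu>0)) \<longlonglongrightarrow> 0" by simp
    moreover have s: "s j > 0" for j unfolding s_def by (simp del: of_nat_Suc)
    ultimately obtain j \<Sigma> where "\<Sigma> \<in> \<CC>" "rej_prob W \<mu>\<^sub>1 (s j) \<Sigma> < d"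
      using small[OF \<mu>0 \<open>d > 0\<close>, of s "\<lambda>_. \<mu>\<^sub>1"] by blast
    then show "\<exists>s\<in>{0<..}. (INF \<Sigma>\<in>\<CC>. rej_prob W \<mu>\<^sub>1 s \<Sigma>) < d"
      using INF_le s by (meson greaterThan_iff le_less_trans)
  qed
  have power: "infimal_power X R r \<CC> W = 0"
    unfolding infimal_power_def
  proof (rule cINF_eq_0I)
    fix d :: real assume "d > 0"
    from near_null[OF zero_less_one this] obtain \<mu> \<Sigma> where
      "\<mu> \<in> hyp_alt X R r" "\<Sigma> \<in> \<CC>" "rej_prob W \<mu> 1 \<Sigma> < d" by blast
    then show "\<exists>p\<in>hyp_alt X R r \<times> {0<..} \<times> \<CC>. (case p of (\<mu>, s, \<Sigma>) \<Rightarrow> rej_prob W \<mu> s \<Sigma>) < d"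
      by (intro bexI[of _ "(\<mu>, 1, \<Sigma>)"]) auto
  qed (auto simp: rej_prob_nonneg)
  obtain \<Sigma> where \<Sigma>: "\<Sigma> \<in> \<CC>" using \<open>\<CC> \<noteq> {}\<close> by blast
  interpret prob_space "gaussian \<mu>0 (1 *\<^sub>R \<Sigma>)" by (rule prob_space_model[OF \<Sigma> zero_less_one])
  have "0 < measure (gaussian \<mu>0 (1 *\<^sub>R \<Sigma>)) U"
    by (rule measure_gaussian_open_pos[OF sym_posdef_scaleR[OF model_posdef[OF \<Sigma>] zero_less_one] U(1,2)])
  also have "\<dots> \<le> rej_prob W \<mu>0 1 \<Sigma>"
    unfolding rej_prob_def by (rule finite_measure_mono) (use U(3) W in auto)
  also have "\<dots> \<le> test_size X R r \<CC> W"
    unfolding test_size_def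
    by (rule cSUP_upper2[where x = "(\<mu>0, 1, \<Sigma>)"])
      (use \<mu>0 \<Sigma> rej_prob_le_1 in \<open>auto intro!: bdd_aboveI2[where M = 1]\<close>)
  finally have "biased X R r \<CC> W" using power by (simp add: biased_def)
  then show ?thesis using null alt large_var power by blast
qed

end


section \<open>The theorem\<close>

theorem theorem3p3:
  fixes X :: "real ^ 'k ^ 'n::{finite,linorder}"
    and R :: "real ^ 'k ^ 'q"
    and r :: "real ^ 'q"
    and \<CC> :: "(real ^ 'n::{finite,linorder} ^ 'n::{finite,linorder}) set"
    and w :: "int \<Rightarrow> real"
    and C :: real
  assumes "CARD('k) < CARD('n)"
    and "rank X = CARD('k)"
    and "rank R = CARD('q)"
    and "covariance_model \<CC>"
    and "AR1_model \<subseteq> \<CC>"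
    and "admissible TYPE('n) w"
    and "rank_condition X R"
    and "0 < C"
  shows
   "\<comment> \<open>the parenthetical ``and hence all'' in the hypotheses of the first two parts\<close>
    (\<forall>e \<in> {e_plus, e_minus}. rank (B_mat X R e) = CARD('q) \<longrightarrow>
       ((\<exists>\<mu>\<in>hyp_null X R r. T_stat X R r w (e + \<mu>) > C) \<longrightarrow>
        (\<forall>\<mu>\<in>hyp_null X R r. T_stat X R r w (e + \<mu>) > C)) \<and>
       ((\<exists>\<mu>\<in>hyp_null X R r. T_stat X R r w (e + \<mu>) < C) \<longrightarrow>
        (\<forall>\<mu>\<in>hyp_null X R r. T_stat X R r w (e + \<mu>) < C)))
    \<and>
    \<comment> \<open>part 1\<close>
    ((rank (B_mat X R e_plus) = CARD('q) \<and>
        (\<exists>\<mu>\<in>hyp_null X R r. T_stat X R r w (e_plus + \<mu>) > C)) \<or>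
     (rank (B_mat X R e_minus) = CARD('q) \<and>
        (\<exists>\<mu>\<in>hyp_null X R r. T_stat X R r w (e_minus + \<mu>) > C))
     \<longrightarrow>
     (\<forall>\<mu>\<^sub>0\<in>hyp_null X R r. \<forall>s>0.
        (SUP \<Sigma>\<in>\<CC>. rej_prob (rejection_region X R r w C) \<mu>\<^sub>0 s \<Sigma>) = 1) \<and>
     test_size X R r \<CC> (rejection_region X R r w C) = 1)
    \<and>
    \<comment> \<open>part 2\<close>
    ((rank (B_mat X R e_plus) = CARD('q) \<and>
        (\<exists>\<mu>\<in>hyp_null X R r. T_stat X R r w (e_plus + \<mu>) < C)) \<or>
     (rank (B_mat X R e_minus) = CARD('q) \<and>
        (\<exists>\<mu>\<in>hyp_null X R r. T_stat X R r w (e_minus + \<mu>) < C))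
     \<longrightarrow>
     (\<forall>\<mu>\<^sub>0\<in>hyp_null X R r. \<forall>s>0.
        (INF \<Sigma>\<in>\<CC>. rej_prob (rejection_region X R r w C) \<mu>\<^sub>0 s \<Sigma>) = 0) \<and>
     (\<forall>s>0. (INF \<mu>\<^sub>1\<in>hyp_alt X R r. INF \<Sigma>\<in>\<CC>.
        rej_prob (rejection_region X R r w C) \<mu>\<^sub>1 s \<Sigma>) = 0) \<and>
     biased X R r \<CC> (rejection_region X R r w C) \<and>
     (\<forall>\<mu>\<^sub>1\<in>hyp_alt X R r. (INF s\<in>{0<..}. INF \<Sigma>\<in>\<CC>.
        rej_prob (rejection_region X R r w C) \<mu>\<^sub>1 s \<Sigma>) = 0) \<and>
     infimal_power X R r \<CC> (rejection_region X R r w C) = 0)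
    \<and>
    \<comment> \<open>part 3\<close>
    ((B_mat X R e_plus = 0 \<and> R *v beta_hat X e_plus \<noteq> 0) \<or>
     (B_mat X R e_minus = 0 \<and> R *v beta_hat X e_minus \<noteq> 0)
     \<longrightarrow>
     (\<forall>\<mu>\<^sub>0\<in>hyp_null X R r. \<forall>s>0.
        (SUP \<Sigma>\<in>\<CC>. rej_prob (rejection_region X R r w C) \<mu>\<^sub>0 s \<Sigma>) = 1) \<and>
     test_size X R r \<CC> (rejection_region X R r w C) = 1)"
proof -
  note rank_X = assms(2) and rank_R = assms(3) and adm = assms(6)
  let ?W = "rejection_region X R r w C"
  let ?reg = "\<lambda>A. {z. det (Omega_hat X R w z) \<noteq> 0 \<and> T_stat X R 0 w z \<in> A}"
  have W: "?W \<in> sets borel" by (rule rejection_region_borel[OF rank_X])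
  have T_shift: "T_stat X R r w (z + \<mu>) = T_stat X R 0 w z" if "\<mu> \<in> hyp_null X R r" for \<mu> z
    by (subst add.commute) (rule T_stat_mean_shift[OF rank_X that])
  have T_centre: "T_stat X R r w y = T_stat X R 0 w (y - \<mu>)" if "\<mu> \<in> hyp_null X R r" for \<mu> y
    using T_shift[OF that, of "y - \<mu>"] by simp
  have cone: "a *\<^sub>R z \<in> ?reg A" if "a \<noteq> 0" "z \<in> ?reg A" for a z A
    using that by (simp add: T_stat_scaleR[OF rank_X] Omega_hat_scaleR[OF rank_X] det_scaleR_nonzero)
  note size = size_eq_1_if_cone_rejects[OF rank_X rank_R assms(4,5) W]
    and power = power_eq_0_if_cone_accepts[OF rank_X rank_R assms(4,5) W]
  have and_hence_all: "\<forall>e \<in> {e_plus, e_minus}. rank (B_mat X R e) = CARD('q) \<longrightarrow>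
       ((\<exists>\<mu>\<in>hyp_null X R r. T_stat X R r w (e + \<mu>) > C) \<longrightarrow>
        (\<forall>\<mu>\<in>hyp_null X R r. T_stat X R r w (e + \<mu>) > C)) \<and>
       ((\<exists>\<mu>\<in>hyp_null X R r. T_stat X R r w (e + \<mu>) < C) \<longrightarrow>
        (\<forall>\<mu>\<in>hyp_null X R r. T_stat X R r w (e + \<mu>) < C))"
    by (auto simp: T_shift)
  have part1: "(\<forall>\<mu>\<^sub>0\<in>hyp_null X R r. \<forall>s>0. (SUP \<Sigma>\<in>\<CC>. rej_prob ?W \<mu>\<^sub>0 s \<Sigma>) = 1) \<and> test_size X R r \<CC> ?W = 1"
    if "(rank (B_mat X R e_plus) = CARD('q) \<and> (\<exists>\<mu>\<in>hyp_null X R r. T_stat X R r w (e_plus + \<mu>) > C)) \<or>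
     (rank (B_mat X R e_minus) = CARD('q) \<and> (\<exists>\<mu>\<in>hyp_null X R r. T_stat X R r w (e_minus + \<mu>) > C))"
  proof (rule size)
    show "open (?reg {C<..})" by (rule open_T_stat_preimage[OF rank_X open_greaterThan])
    show "e_plus \<in> ?reg {C<..} \<or> e_minus \<in> ?reg {C<..}"
      using that by (auto simp: T_shift Omega_hat_nonsingular_iff[OF rank_X adm])
    show "AE y in lborel. y - \<mu>0 \<in> ?reg {C<..} \<longrightarrow> y \<in> ?W" if "\<mu>0 \<in> hyp_null X R r" for \<mu>0
      by (rule AE_I2) (simp add: rejection_region_def T_centre[OF that])
  qed (rule cone)
  have part2: "(\<forall>\<mu>\<^sub>0\<in>hyp_null X R r. \<forall>s>0. (INF \<Sigma>\<in>\<CC>. rej_prob ?W \<mu>\<^sub>0 s \<Sigma>) = 0) \<and>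
     (\<forall>s>0. (INF \<mu>\<^sub>1\<in>hyp_alt X R r. INF \<Sigma>\<in>\<CC>. rej_prob ?W \<mu>\<^sub>1 s \<Sigma>) = 0) \<and>
     biased X R r \<CC> ?W \<and>
     (\<forall>\<mu>\<^sub>1\<in>hyp_alt X R r. (INF s\<in>{0<..}. INF \<Sigma>\<in>\<CC>. rej_prob ?W \<mu>\<^sub>1 s \<Sigma>) = 0) \<and>
     infimal_power X R r \<CC> ?W = 0"
    if e: "(rank (B_mat X R e_plus) = CARD('q) \<and> (\<exists>\<mu>\<in>hyp_null X R r. T_stat X R r w (e_plus + \<mu>) < C)) \<or>
     (rank (B_mat X R e_minus) = CARD('q) \<and> (\<exists>\<mu>\<in>hyp_null X R r. T_stat X R r w (e_minus + \<mu>) < C))"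
  proof (rule power)
    show "open (?reg {..<C})" by (rule open_T_stat_preimage[OF rank_X open_lessThan])
    show "e_plus \<in> ?reg {..<C} \<or> e_minus \<in> ?reg {..<C}"
      using e by (auto simp: T_shift Omega_hat_nonsingular_iff[OF rank_X adm])
    show "y \<notin> ?W" if "\<mu>0 \<in> hyp_null X R r" "y - \<mu>0 \<in> ?reg {..<C}" for \<mu>0 y
      using that(2) by (simp add: rejection_region_def T_centre[OF that(1)])
    \<comment> \<open>nonempty as \<open>T\<close> exceeds every level somewhere, which is what bias needs\<close>
    let ?U = "{y. det (Omega_hat X R w y) \<noteq> 0 \<and> T_stat X R r w y \<in> {C<..}}"
    show "open ?U" by (rule open_T_stat_preimage[OF rank_X open_greaterThan])
    show "?U \<subseteq> ?W" by (auto simp: rejection_region_def)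
    obtain z where z: "det (Omega_hat X R w z) \<noteq> 0" "T_stat X R 0 w z > C"
      using e T_stat_unbounded[OF rank_X adm rank_R _ assms(8)] by blast
    obtain \<mu> where \<mu>: "\<mu> \<in> hyp_null X R r" using hyp_null_nonempty[OF rank_R] by blast
    then obtain b where "\<mu> = X *v b" by (auto simp: hyp_null_def)
    then have "\<mu> + z \<in> ?U"
      using z Omega_hat_mean_shift[OF rank_X, of R w b z] T_stat_mean_shift[OF rank_X \<mu>, of w z] by simp
    then show "?U \<noteq> {}" by blast
  qed (rule cone)
  have part3: "(\<forall>\<mu>\<^sub>0\<in>hyp_null X R r. \<forall>s>0. (SUP \<Sigma>\<in>\<CC>. rej_prob ?W \<mu>\<^sub>0 s \<Sigma>) = 1) \<and> test_size X R r \<CC> ?W = 1"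
    if e: "(B_mat X R e_plus = 0 \<and> R *v beta_hat X e_plus \<noteq> 0) \<or>
     (B_mat X R e_minus = 0 \<and> R *v beta_hat X e_minus \<noteq> 0)"
  proof (rule size)
    let ?b = "\<lambda>z. R *v beta_hat X z"
    \<comment> \<open>At \<open>e\<close> the left side is zero, since \<open>\<Omega>(e) = 0\<close>, and the right side is positive.\<close>
    let ?V = "{z. C * (?b z \<bullet> (Omega_hat X R w z *v ?b z)) < (?b z \<bullet> ?b z)\<^sup>2}"
    show "open ?V"
      by (intro open_Collect_less continuous_intros continuous_on_Omega_hat[OF rank_X] continuous_on_beta_hat)
    show "a *\<^sub>R z \<in> ?V" if "a \<noteq> 0" "z \<in> ?V" for a z
    proof -
      have "C * (?b (a *\<^sub>R z) \<bullet> (Omega_hat X R w (a *\<^sub>R z) *v ?b (a *\<^sub>R z))) =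
          a ^ 4 * (C * (?b z \<bullet> (Omega_hat X R w z *v ?b z)))"
        by (simp add: Omega_hat_scaleR[OF rank_X] beta_hat_scaleR matrix_vector_mult_scaleR
            scaleR_matrix_vector_assoc[symmetric] power2_eq_square power4_eq_xxxx)
      moreover have "(?b (a *\<^sub>R z) \<bullet> ?b (a *\<^sub>R z))\<^sup>2 = a ^ 4 * (?b z \<bullet> ?b z)\<^sup>2"
        by (simp add: beta_hat_scaleR matrix_vector_mult_scaleR power2_eq_square power4_eq_xxxx)
      moreover have "a ^ 4 > 0" using that(1) by simp
      ultimately show ?thesis using that(2) by (simp only: mem_Collect_eq mult_less_cancel_left_pos)
    qed
    show "e_plus \<in> ?V \<or> e_minus \<in> ?V"
      using e by (auto simp: Omega_hat_eq[OF rank_X])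
    show "AE y in lborel. y - \<mu>0 \<in> ?V \<longrightarrow> y \<in> ?W" if null: "\<mu>0 \<in> hyp_null X R r" for \<mu>0
      using AE_Omega_hat_nonsingular[OF rank_X adm assms(7)]
    proof eventually_elim
      case (elim y)
      obtain b where b: "\<mu>0 = X *v b" using null by (auto simp: hyp_null_def)
      have "det (Omega_hat X R w (y - \<mu>0)) \<noteq> 0"
        using elim Omega_hat_mean_shift[OF rank_X, of R w b "y - \<mu>0"] by (simp add: b)
      then have "T_stat X R 0 w (y - \<mu>0) > C" if "y - \<mu>0 \<in> ?V"
        using T_stat_gt[OF rank_X adm _ assms(8), of R "y - \<mu>0" "?b (y - \<mu>0)" 0] that by simp
      then show ?case by (auto simp: rejection_region_def T_centre[OF null] intro: less_imp_le)
    qed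
  qed
  show ?thesis using and_hence_all part1 part2 part3 by blast
qed

end
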